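(* For any integer $w > 0$ and finite field $\mathbb{F}_q$, the class $\mathcal{P}_{w,q}$ has finitely many excluded minors. Consequently, the code family $\mathfrak{C}(\mathcal{P}_{w,q}) = \{\mathcal{C} : \mathcal{C} \text{ is a linear code over } \mathbb{F}_q \text{ with } \mathrm{tw}(\mathcal{C}) \le w\}$ also has finitely many excluded minors.
   Context: $\mathcal{P}_{w,q}$ is the class of $\mathbb{F}_q$-representable matroids of pathwidth at most $w$, where for a matroid $M$, $\lambda_M(X) = r_M(X)+r_M(E(M)-X)-r_M(E(M))$, the width of an ordering $(e_1,\ldots,e_n)$ of $E(M)$ is $\max_i\lambda_M(\{e_1,\ldots,e_i\})$, and $\mathrm{pw}(M)$ is the minimum width over orderings. An excluded minor for $\mathcal{P}_{w,q}$ is an $\mathbb{F}_q$-representable matroid not in the class all of whose proper minors are in it. For a linear code $\mathcal{C}$ over $\mathbb{F}_q$, $M(\mathcal{C})$ is the vector matroid of a generator matrix, and $\mathrm{tw}(\mathcal{C}) = \mathrm{pw}(M(\mathcal{C}))$. Code minors are codes obtained by puncturing (deleting coordinates; corresponds to matroid deletion) and shortening (corresponds to matroid contraction); two codes are equivalent if one is obtained from the other by multiplying coordinates by nonzero scalars and permuting coordinates. A code family is minor-closed if it contains every code equivalent to a minor of any of its members; an excluded minor of such a family is a code not in the family all of whose proper minors are in it. *)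

theory Defs
  imports "Jordan_Normal_Form.VS_Connect"
begin

section \<open>Matroids\<close>

record 'a matroid =
  ground :: "'a set"
  indeps :: "'a set set"

definition is_matroid :: "'a matroid \<Rightarrow> bool" where
  "is_matroid M \<longleftrightarrow>
     finite (ground M) \<and> indeps M \<subseteq> Pow (ground M) \<and> {} \<in> indeps M \<and>
     (\<forall>I\<in>indeps M. \<forall>J. J \<subseteq> I \<longrightarrow> J \<in> indeps M) \<and>
     (\<forall>I\<in>indeps M. \<forall>J\<in>indeps M. card J < card I \<longrightarrow>
        (\<exists>x\<in>I - J. insert x J \<in> indeps M))"

definition matroid_iso :: "'a matroid \<Rightarrow> 'b matroid \<Rightarrow> bool" where
  "matroid_iso M N \<longleftrightarrow>
     (\<exists>f. bij_betw f (ground M) (ground N) \<and> indeps N = (\<lambda>I. f ` I) ` indeps M)"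

definition matroid_iso_rel :: "('a matroid \<times> 'a matroid) set" where
  "matroid_iso_rel = {(M, N). matroid_iso M N}"

definition matroid_rank :: "'a matroid \<Rightarrow> 'a set \<Rightarrow> nat" where
  "matroid_rank M X = Max (card ` {I \<in> indeps M. I \<subseteq> X})"

subsection \<open>Minors\<close>

definition matroid_delete :: "'a matroid \<Rightarrow> 'a set \<Rightarrow> 'a matroid" where
  "matroid_delete M X =
     \<lparr>ground = ground M - X, indeps = {I \<in> indeps M. I \<subseteq> ground M - X}\<rparr>"

text \<open>The matroid with rank function \<open>r(I \<union> X) - r(X)\<close>: a set is independent iff its rank is its
  cardinality.\<close>

definition matroid_contract :: "'a matroid \<Rightarrow> 'a set \<Rightarrow> 'a matroid" where
  "matroid_contract M X =
     \<lparr>ground = ground M - X,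
      indeps = {I. I \<subseteq> ground M - X \<and> matroid_rank M (I \<union> X) = card I + matroid_rank M X}\<rparr>"

definition proper_matroid_minor :: "'a matroid \<Rightarrow> 'a matroid \<Rightarrow> bool" where
  "proper_matroid_minor N M \<longleftrightarrow>
     (\<exists>X Y. X \<subseteq> ground M \<and> Y \<subseteq> ground M \<and> X \<inter> Y = {} \<and> X \<union> Y \<noteq> {} \<and>
            N = matroid_delete (matroid_contract M X) Y)"

subsection \<open>Representability\<close>

text \<open>The ground set consists of the column indices, so repeated columns are distinct, parallel
  elements; the injectivity condition makes a set of indices with a repeated column dependent.\<close>

definition vector_matroid :: "'f::field mat \<Rightarrow> nat matroid" where
  "vector_matroid A =
     \<lparr>ground = {..<dim_col A},
      indeps = {J. J \<subseteq> {..<dim_col A} \<and> inj_on (col A) J \<and>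
                   \<not> module.lin_dep class_ring (module_vec TYPE('f) (dim_row A)) (col A ` J)}\<rparr>"

definition representable :: "'f::field itself \<Rightarrow> 'a matroid \<Rightarrow> bool" where
  "representable _ M \<longleftrightarrow>
     is_matroid M \<and> (\<exists>A :: 'f mat. matroid_iso M (vector_matroid A))"

subsection \<open>Pathwidth\<close>

text \<open>Integer-valued in order to avoid truncated subtraction.\<close>

definition connectivity :: "'a matroid \<Rightarrow> 'a set \<Rightarrow> int" where
  "connectivity M X =
     int (matroid_rank M X) + int (matroid_rank M (ground M - X)) - int (matroid_rank M (ground M))"

text \<open>The empty prefix, whose connectivity is 0, is included so that the maximum is also defined
  for the empty ordering; otherwise it contributes nothing, since connectivity is nonnegative.\<close>

definition ordering_width :: "'a matroid \<Rightarrow> 'a list \<Rightarrow> int" where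
  "ordering_width M es = Max ((\<lambda>i. connectivity M (set (take i es))) ` {0..length es})"

definition pathwidth :: "'a matroid \<Rightarrow> int" where
  "pathwidth M = Min (ordering_width M ` {es. distinct es \<and> set es = ground M})"

definition pathwidth_class :: "'f::field itself \<Rightarrow> int \<Rightarrow> 'a matroid set" where
  "pathwidth_class F w = {M. representable F M \<and> pathwidth M \<le> w}"

definition matroid_excluded_minors ::
  "'f::field itself \<Rightarrow> 'a matroid set \<Rightarrow> 'a matroid set" where
  "matroid_excluded_minors F \<M> =
     {M. representable F M \<and> M \<notin> \<M> \<and> (\<forall>N. proper_matroid_minor N M \<longrightarrow> N \<in> \<M>)}"


section \<open>Linear codes\<close>

text \<open>A code of length \<open>n\<close> is a subspace of the space of vectors of dimension \<open>n\<close>. It is never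
  empty, so it determines its length.\<close>

definition linear_code_of_length :: "nat \<Rightarrow> 'f::field vec set \<Rightarrow> bool" where
  "linear_code_of_length n C \<longleftrightarrow> subspace class_ring C (module_vec TYPE('f) n)"

definition linear_code :: "'f::field vec set \<Rightarrow> bool" where
  "linear_code C \<longleftrightarrow> (\<exists>n. linear_code_of_length n C)"

definition is_generator_matrix :: "'f::field mat \<Rightarrow> 'f vec set \<Rightarrow> bool" where
  "is_generator_matrix G C \<longleftrightarrow>
     distinct (rows G) \<and>
     \<not> module.lin_dep class_ring (module_vec TYPE('f) (dim_col G)) (set (rows G)) \<and>
     vec_space.row_space (dim_col G) G = C"

text \<open>The vector matroid does not depend on the choice of the generator matrix.\<close>

definition code_matroid :: "'f::field vec set \<Rightarrow> nat matroid" where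
  "code_matroid C = vector_matroid (SOME G. is_generator_matrix G C)"

definition trellis_width :: "'f::field vec set \<Rightarrow> int" where
  "trellis_width C = pathwidth (code_matroid C)"

definition pathwidth_code_family :: "int \<Rightarrow> 'f::field vec set set" where
  "pathwidth_code_family w = {C. linear_code C \<and> trellis_width C \<le> w}"

subsection \<open>Minors\<close>

definition drop_coord :: "nat \<Rightarrow> 'f vec \<Rightarrow> 'f vec" where
  "drop_coord i v = vec (dim_vec v - 1) (\<lambda>j. if j < i then v $ j else v $ Suc j)"

definition puncture :: "nat \<Rightarrow> 'f vec set \<Rightarrow> 'f vec set" where
  "puncture i C = drop_coord i ` C"

definition shorten :: "nat \<Rightarrow> 'f::zero vec set \<Rightarrow> 'f vec set" where
  "shorten i C = drop_coord i ` {c \<in> C. c $ i = 0}"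

text \<open>\<open>code_minor_step D C\<close>: \<open>D\<close> arises from \<open>C\<close> by puncturing or shortening one coordinate. A minor
  is proper if at least one coordinate has been removed.\<close>

definition code_minor_step :: "'f::field vec set \<Rightarrow> 'f vec set \<Rightarrow> bool" where
  "code_minor_step D C \<longleftrightarrow>
     (\<exists>n i. linear_code_of_length n C \<and> i < n \<and> (D = puncture i C \<or> D = shorten i C))"

definition proper_code_minor :: "'f::field vec set \<Rightarrow> 'f vec set \<Rightarrow> bool" where
  "proper_code_minor = code_minor_step\<^sup>+\<^sup>+"

definition code_excluded_minors :: "'f::field vec set set \<Rightarrow> 'f vec set set" where
  "code_excluded_minors \<C> =
     {C. linear_code C \<and> C \<notin> \<C> \<and> (\<forall>D. proper_code_minor D C \<longrightarrow> D \<in> \<C>)}"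

end

(* An excluded minor loses one element to reach pathwidth at most w, so it has pathwidth at most
   w + 1. It therefore suffices that in every infinite sequence of codes over a finite field with
   orderings of bounded width some code is, up to permuting coordinates, a minor of a later one;
   then excluded minors of unbounded size would contain one another properly.

   Such an ordering turns a code into a trellis, that is, a word of relations between state sets of
   size q^(connectivity of the cut). An ordering that minimises the sum of the connectivities of
   its cuts is linked, and Tutte's linking argument then provides, between any two consecutive cuts
   of equal width k with only wider cuts in between, deletions and contractions that reduce the part
   in between to a bijection of states. Labelling the states from left to right makes
   all these bijections identities, so parts between such cuts can be skipped. Cutting words at
   their cuts of minimal width, recursively in the width, presents them as nested finite sequences
   over a finite alphabet, and one application of Higman's lemma per width gives the claim. *)
theory Submission
  imports Defs "HOL-Library.Cardinality" "HOL-Library.Ramsey" "HOL-Library.Sublist"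
begin

text \<open>The obstacle is that part of a trellis can be skipped only if some deletions and
  contractions make it the identity on numbered states; a mere bijection of states would not do.
  Embeddings are therefore built by skipping whole segments between cuts of equal connectivity k,
  which is what Higman's lemma provides: it drops entire pieces of one height and keeps the
  outermost letters of the others. Adding an element changes connectivity by at most 1, so an
  excursion above k starts with a letter from k to k + 1 and ends with one from k + 1 to k; this
  makes the recursion in the width exhaustive, and the bound on the width makes it stop. Linkedness
  is needed because Tutte's argument asks for connectivity at least k of every set between the two
  cuts, not only of the cuts of the ordering. At both ends of an ordering the connectivity is 0, so
  there is one state, the whole word is a sequence of pieces of height 0, and equal behaviours of
  words mean equal codes. The widths of minors need not be followed, since all proper minors of an
  excluded minor have small width anyhow.\<close>

section \<open>Rank functions of codes\<close>

text \<open>For the row space \<open>C\<close> of a matrix, \<open>free_on C I\<close> says that the columns indexed by \<open>I\<close> are linearly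
  independent. Working with row spaces lets dimensions be read off from cardinalities.\<close>

definition free_on :: "('e \<Rightarrow> 'f) set \<Rightarrow> 'e set \<Rightarrow> bool" where
  "free_on C I \<longleftrightarrow> (\<forall>g. \<exists>c\<in>C. \<forall>e\<in>I. c e = g e)"

definition crank :: "('e \<Rightarrow> 'f) set \<Rightarrow> 'e set \<Rightarrow> nat" where
  "crank C X = Max (card ` {I. I \<subseteq> X \<and> free_on C I})"

definition restr :: "'e set \<Rightarrow> ('e \<Rightarrow> 'f::zero) \<Rightarrow> 'e \<Rightarrow> 'f" where
  "restr X c = (\<lambda>e. if e \<in> X then c e else 0)"

definition shortened :: "('e \<Rightarrow> 'f::zero) set \<Rightarrow> 'e set \<Rightarrow> ('e \<Rightarrow> 'f) set" where
  "shortened C X = {c \<in> C. \<forall>e\<in>X. c e = 0}"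

text \<open>Codewords are functions on the whole type, and the ground set is a separate argument
  wherever it matters. Deletion then only shrinks the ground set, and contraction is
  \<open>shortened\<close>; coordinates outside the ground set may hold anything.\<close>

definition fcode :: "('e \<Rightarrow> 'f::field) set \<Rightarrow> bool" where
  "fcode C \<longleftrightarrow> finite C \<and> (\<lambda>_. 0) \<in> C \<and> (\<forall>c\<in>C. \<forall>d\<in>C. (\<lambda>e. c e + d e) \<in> C) \<and>
     (\<forall>a. \<forall>c\<in>C. (\<lambda>e. a * c e) \<in> C)"

lemma fcode_add: "fcode C \<Longrightarrow> c \<in> C \<Longrightarrow> d \<in> C \<Longrightarrow> (\<lambda>e. c e + d e) \<in> C"
  unfolding fcode_def by blast

lemma fcode_scale: "fcode C \<Longrightarrow> c \<in> C \<Longrightarrow> (\<lambda>e. a * c e) \<in> C"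
  unfolding fcode_def by blast

lemma fcode_diff: "fcode C \<Longrightarrow> c \<in> C \<Longrightarrow> d \<in> C \<Longrightarrow> (\<lambda>e. c e - d e) \<in> C"
  using fcode_add[OF _ _ fcode_scale[of C d "- 1"], of c] by simp

lemma fcode_zero: "fcode C \<Longrightarrow> (\<lambda>_. 0) \<in> C"
  unfolding fcode_def by blast

lemma fcode_finite: "fcode C \<Longrightarrow> finite C"
  unfolding fcode_def by blast

lemma shortened_fcode: "fcode C \<Longrightarrow> fcode (shortened C X)"
  unfolding fcode_def shortened_def by auto

lemma shortened_shortened: "shortened (shortened C X) Y = shortened C (X \<union> Y)"
  unfolding shortened_def by auto

lemma shortened_empty [simp]: "shortened C {} = C"
  unfolding shortened_def by auto

lemma restr_eq_iff: "restr X c = restr X d \<longleftrightarrow> (\<forall>e\<in>X. c e = d e)"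
  unfolding restr_def fun_eq_iff by auto

text \<open>The fibres of \<open>f\<close> are translates of \<open>H\<close>. The target of
  \<open>f\<close> is an arbitrary type, so that this serves for projections as well as for
  numberings of states.\<close>

lemma card_fibres:
  fixes f :: "('e \<Rightarrow> 'f::field) \<Rightarrow> 'b"
  assumes C: "fcode C" and H: "H \<subseteq> C"
    and ker: "\<And>c d. c \<in> C \<Longrightarrow> d \<in> C \<Longrightarrow> f c = f d \<longleftrightarrow> (\<lambda>e. c e - d e) \<in> H"
  shows "card C = card (f ` C) * card H"
proof -
  have fib: "card {c \<in> C. f c = y} = card H" if y: "y \<in> f ` C" for y
  proof -
    obtain d where d: "d \<in> C" "y = f d" using y by blast
    have "bij_betw (\<lambda>h e. h e + d e) H {c \<in> C. f c = y}"
    proof (rule bij_betw_byWitness[where f' = "\<lambda>c e. c e - d e"])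
      show "(\<lambda>h e. h e + d e) ` H \<subseteq> {c \<in> C. f c = y}"
      proof clarify
        fix h assume h: "h \<in> H"
        then have m: "(\<lambda>e. h e + d e) \<in> C" using fcode_add[OF C] H d by blast
        have "(\<lambda>e. (h e + d e) - d e) \<in> H" using h by simp
        then show "(\<lambda>e. h e + d e) \<in> C \<and> f (\<lambda>e. h e + d e) = y"
          using ker[OF m d(1)] m d(2) by blast
      qed
      show "(\<lambda>c e. c e - d e) ` {c \<in> C. f c = y} \<subseteq> H" using ker[OF _ d(1)] d(2) by auto
    qed auto
    then show ?thesis by (simp add: bij_betw_same_card)
  qed
  have "card C = (\<Sum>y\<in>f ` C. \<Sum>c\<in>{c \<in> C. f c = y}. 1)"
    using sum.image_gen[OF fcode_finite[OF C], of "\<lambda>_. 1::nat" f] by simp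
  also have "\<dots> = (\<Sum>y\<in>f ` C. card H)" using fib by (intro sum.cong) auto
  finally show ?thesis by simp
qed

lemma card_restr_shortened:
  "fcode C \<Longrightarrow> card C = card (restr X ` C) * card (shortened C X)"
  by (rule card_fibres) (auto simp: restr_eq_iff shortened_def fcode_diff)

lemma card_field_gt_1: "1 < CARD('f::{field,finite})"
proof -
  have "card {0, 1::'f} \<le> CARD('f)" by (rule card_mono) auto
  then show ?thesis by simp
qed

lemma card_restr_free:
  fixes C :: "('e \<Rightarrow> 'f::{field,finite}) set"
  assumes "finite I" "free_on C I"
  shows "card (restr I ` C) = CARD('f) ^ card I"
proof -
  have "bij_betw (\<lambda>c. restrict c I) (restr I ` C) (I \<rightarrow>\<^sub>E (UNIV :: 'f set))"
  proof (rule bij_betw_imageI)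
    show "inj_on (\<lambda>c. restrict c I) (restr I ` C)"
    proof (rule inj_onI)
      fix x y assume xy: "x \<in> restr I ` C" "y \<in> restr I ` C" "restrict x I = restrict y I"
      show "x = y"
      proof
        fix e show "x e = y e"
          using xy(1,2) fun_cong[OF xy(3), of e] by (cases "e \<in> I") (force simp: restr_def)+
      qed
    qed
    show "(\<lambda>c. restrict c I) ` restr I ` C = (I \<rightarrow>\<^sub>E UNIV)"
    proof
      show "(I \<rightarrow>\<^sub>E UNIV) \<subseteq> (\<lambda>c. restrict c I) ` restr I ` C"
      proof
        fix g :: "'e \<Rightarrow> 'f" assume g: "g \<in> (I \<rightarrow>\<^sub>E UNIV)"
        obtain c where c: "c \<in> C" "\<forall>e\<in>I. c e = g e" using assms(2) unfolding free_on_def by blast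
        have "restrict (restr I c) I = g" using c g
          by (auto simp: fun_eq_iff restr_def PiE_def extensional_def)
        then show "g \<in> (\<lambda>c. restrict c I) ` restr I ` C" using c by blast
      qed
    qed auto
  qed
  then show ?thesis using assms(1) by (simp add: bij_betw_same_card card_PiE)
qed

lemma crank_witness:
  assumes "finite X" "C \<noteq> {}"
  obtains I where "I \<subseteq> X" "free_on C I" "card I = crank C X"
proof -
  let ?S = "{I. I \<subseteq> X \<and> free_on C I}"
  have "finite ?S" using assms by simp
  moreover have "{} \<in> ?S" using assms by (auto simp: free_on_def)
  ultimately have "Max (card ` ?S) \<in> card ` ?S" by (intro Max_in) auto
  then show ?thesis using that unfolding crank_def by auto
qed

lemma crank_ge: "finite X \<Longrightarrow> I \<subseteq> X \<Longrightarrow> free_on C I \<Longrightarrow> card I \<le> crank C X"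
  unfolding crank_def by (intro Max_ge) auto

lemma free_on_insert:
  assumes C: "fcode C" and I: "free_on C I" and c: "c \<in> C" "\<forall>e\<in>I. c e = 0" "c x \<noteq> 0"
  shows "free_on C (insert x I)"
  unfolding free_on_def
proof
  fix g :: "'a \<Rightarrow> 'b"
  obtain d where d: "d \<in> C" "\<forall>e\<in>I. d e = g e" using I unfolding free_on_def by blast
  let ?d = "\<lambda>e. d e + ((g x - d x) / c x) * c e"
  have "?d \<in> C" using fcode_add[OF C d(1) fcode_scale[OF C c(1)]] .
  moreover have "\<forall>e\<in>insert x I. ?d e = g e" using c d by auto
  ultimately show "\<exists>c\<in>C. \<forall>e\<in>insert x I. c e = g e" by (intro bexI[of _ ?d])
qed

text \<open>A codeword that is 0 on a largest free \<open>I\<close> in \<open>X\<close> but not at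
  some \<open>x\<close> of \<open>X\<close> would make \<open>insert x I\<close> free. Hence
  projecting to \<open>I\<close> loses nothing that \<open>X\<close> sees, and \<open>crank\<close>
  is the logarithm of the size of a projection.\<close>

lemma card_restr:
  fixes C :: "('e \<Rightarrow> 'f::{field,finite}) set"
  assumes C: "fcode C" and X: "finite X"
  shows "card (restr X ` C) = CARD('f) ^ crank C X"
proof -
  obtain I where I: "I \<subseteq> X" "free_on C I" "card I = crank C X"
    using crank_witness[OF X] fcode_zero[OF C] by blast
  have fI: "finite I" using I X finite_subset by blast
  have sh: "shortened C I = shortened C X"
  proof -
    have "c x = 0" if c: "c \<in> C" "\<forall>e\<in>I. c e = 0" and x: "x \<in> X" for c x
    proof (rule ccontr)
      assume "c x \<noteq> 0"
      then have fr: "free_on C (insert x I)" using free_on_insert[OF C I(2) c] by blast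
      have "x \<notin> I" using \<open>c x \<noteq> 0\<close> c by auto
      then have "card (insert x I) = Suc (crank C X)" using fI I by simp
      with crank_ge[OF X _ fr] I x show False by auto
    qed
    then show ?thesis using I(1) unfolding shortened_def by blast
  qed
  have pos: "card (shortened C X) > 0"
    using fcode_finite[OF C] fcode_zero[OF C] unfolding shortened_def
    by (auto simp: card_gt_0_iff)
  have "card (restr X ` C) = card (restr I ` C)"
    using card_restr_shortened[OF C, of I] card_restr_shortened[OF C, of X] pos sh by simp
  then show ?thesis using card_restr_free[OF fI I(2)] I(3) by simp
qed

lemma shortened_pos: "fcode C \<Longrightarrow> 0 < card (shortened C X)"
  using fcode_finite[OF shortened_fcode, of C X] fcode_zero[OF shortened_fcode, of C X]
  by (auto simp: card_gt_0_iff)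

lemma card_eq_crank_shortened:
  fixes C :: "('e \<Rightarrow> 'f::{field,finite}) set"
  assumes "fcode C" "finite X"
  shows "card C = CARD('f) ^ crank C X * card (shortened C X)"
  using card_restr_shortened[OF assms(1), of X] card_restr[OF assms] by simp

text \<open>This is the rank formula of a contraction. It follows by counting \<open>C\<close>, and
  the words of \<open>C\<close> vanishing on \<open>X\<close>, relative to the words vanishing on
  \<open>X \<union> Z\<close>.\<close>

lemma crank_shortened:
  fixes C :: "('e \<Rightarrow> 'f::{field,finite}) set"
  assumes C: "fcode C" and X: "finite X" and Z: "finite Z"
  shows "crank C (X \<union> Z) = crank (shortened C X) Z + crank C X"
proof -
  let ?q = "CARD('f)"
  have "card (shortened C X) = ?q ^ crank (shortened C X) Z * card (shortened C (X \<union> Z))"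
    using card_eq_crank_shortened[OF shortened_fcode[OF C] Z, of X]
    by (simp only: shortened_shortened)
  moreover have "card C = ?q ^ crank C X * card (shortened C X)"
    using card_eq_crank_shortened[OF C X] .
  moreover have "card C = ?q ^ crank C (X \<union> Z) * card (shortened C (X \<union> Z))"
    using card_eq_crank_shortened[OF C] X Z by blast
  ultimately have "?q ^ crank C (X \<union> Z) = ?q ^ (crank (shortened C X) Z + crank C X)"
    using shortened_pos[OF C, of "X \<union> Z"] by (simp add: power_add)
  then show ?thesis using card_field_gt_1[where 'f='f] by (simp add: power_inject_exp)
qed

lemma crank_mono: "finite Y \<Longrightarrow> X \<subseteq> Y \<Longrightarrow> C \<noteq> {} \<Longrightarrow> crank C X \<le> crank C Y"
  by (metis crank_ge crank_witness finite_subset order_trans)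

lemma crank_le_card: "finite X \<Longrightarrow> C \<noteq> {} \<Longrightarrow> crank C X \<le> card X"
  by (metis card_mono crank_witness)

lemma crank_subadd:
  fixes C :: "('e \<Rightarrow> 'f::{field,finite}) set"
  assumes C: "fcode C" and X: "finite X" and Y: "finite Y"
  shows "crank C (X \<union> Y) \<le> crank C X + crank C Y"
proof -
  let ?h = "\<lambda>c. (restr X c, restr Y c)"
  have fin: "finite (restr X ` C \<times> restr Y ` C)" using fcode_finite[OF C] by simp
  have r: "restr X (restr (X \<union> Y) c) = restr X c" "restr Y (restr (X \<union> Y) c) = restr Y c"
    for c :: "'e \<Rightarrow> 'f" by (auto simp: restr_def)
  have "inj_on ?h (restr (X \<union> Y) ` C)"
  proof (rule inj_onI)
    fix x y assume "x \<in> restr (X \<union> Y) ` C" "y \<in> restr (X \<union> Y) ` C" and h: "?h x = ?h y"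
    then obtain c d where cd: "x = restr (X \<union> Y) c" "y = restr (X \<union> Y) d" by blast
    have "restr X c = restr X d" "restr Y c = restr Y d" using h unfolding cd by (simp_all only: r prod.inject)
    then show "x = y" unfolding cd restr_eq_iff by auto
  qed
  moreover have "?h ` restr (X \<union> Y) ` C \<subseteq> restr X ` C \<times> restr Y ` C"
    by (auto simp only: r image_iff mem_Times_iff fst_conv snd_conv)
  ultimately have "card (restr (X \<union> Y) ` C) \<le> card (restr X ` C \<times> restr Y ` C)"
    by (rule card_inj_on_le[OF _ _ fin])
  then have "CARD('f) ^ crank C (X \<union> Y) \<le> CARD('f) ^ (crank C X + crank C Y)"
    using X Y by (simp add: card_cartesian_product card_restr[OF C] power_add)
  then show ?thesis using card_field_gt_1[where 'f='f] by (simp add: power_increasing_iff)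
qed

text \<open>Contracting \<open>X \<inter> Y\<close> reduces this to subadditivity.\<close>

lemma crank_submodular:
  fixes C :: "('e \<Rightarrow> 'f::{field,finite}) set"
  assumes C: "fcode C" and X: "finite X" and Y: "finite Y"
  shows "crank C (X \<union> Y) + crank C (X \<inter> Y) \<le> crank C X + crank C Y"
proof -
  let ?W = "X \<inter> Y"
  have W: "finite ?W" using X by simp
  have e: "?W \<union> (X \<union> Y) = X \<union> Y" "?W \<union> X = X" "?W \<union> Y = Y" by auto
  show ?thesis
    using crank_shortened[OF C W, of "X \<union> Y"] crank_shortened[OF C W, of X]
      crank_shortened[OF C W, of Y] crank_subadd[OF shortened_fcode[OF C, of ?W] X Y] X Y
    unfolding e by simp
qed

section \<open>Connectivity and linking\<close>

definition lam :: "'e set \<Rightarrow> ('e \<Rightarrow> 'f) set \<Rightarrow> 'e set \<Rightarrow> nat" where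
  "lam E C A = crank C A + crank C (E - A) - crank C E"

text \<open>By subadditivity the truncated subtraction in \<open>lam\<close> is exact; the additive
  form is the one suited to linear arithmetic.\<close>

lemma lam_add:
  fixes C :: "('e \<Rightarrow> 'f::{field,finite}) set"
  assumes "fcode C" "finite E" "A \<subseteq> E"
  shows "lam E C A + crank C E = crank C A + crank C (E - A)"
proof -
  have "A \<union> (E - A) = E" using assms by auto
  then show ?thesis
    using crank_subadd[OF assms(1), of A "E - A"] assms finite_subset[of A E]
    unfolding lam_def by auto
qed

lemma lam_submodular:
  fixes C :: "('e \<Rightarrow> 'f::{field,finite}) set"
  assumes C: "fcode C" and E: "finite E" and X: "X \<subseteq> E" and Y: "Y \<subseteq> E"
  shows "lam E C (X \<union> Y) + lam E C (X \<inter> Y) \<le> lam E C X + lam E C Y"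
proof -
  have f: "finite X" "finite Y" "finite (E - X)" "finite (E - Y)"
    using E X Y finite_subset by auto
  have e: "(E - X) \<union> (E - Y) = E - (X \<inter> Y)" "(E - X) \<inter> (E - Y) = E - (X \<union> Y)" by auto
  have sub: "X \<union> Y \<subseteq> E" "X \<inter> Y \<subseteq> E" using X Y by auto
  show ?thesis
    using lam_add[OF C E X] lam_add[OF C E Y] lam_add[OF C E sub(1)] lam_add[OF C E sub(2)]
      crank_submodular[OF C f(1,2)] crank_submodular[OF C f(3,4)] unfolding e by linarith
qed

text \<open>Tutte's argument: if neither deleting nor contracting \<open>x\<close> preserves connectivity \<open>k\<close>, uncrossing
  the two separations that witness this gives the contradiction \<open>2 * k \<le> 2 * k - 1\<close>.\<close>

lemma linking:
  fixes C :: "('e \<Rightarrow> 'f::{field,finite}) set"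
  assumes "finite W" "finite A" "finite B" "A \<inter> B = {}" "W \<inter> (A \<union> B) = {}" "fcode C"
    and "\<And>Z. Z \<subseteq> W \<Longrightarrow> k \<le> lam (A \<union> W \<union> B) C (A \<union> Z)"
  shows "\<exists>X\<subseteq>W. k \<le> lam (A \<union> B) (shortened C X) A"
  using assms
proof (induction W arbitrary: C rule: finite_induct)
  case empty
  then show ?case by force
next
  case (insert x W)
  let ?E = "A \<union> W \<union> B"
  have x: "x \<notin> ?E" and C: "fcode C" using insert.prems(3-5) insert.hyps by auto
  have E: "finite ?E" using insert.prems(1,2) insert.hyps by auto
  show ?case
  \<comment> \<open>First try to delete \<open>x\<close>: the code stays as it is and only the
    ground set loses \<open>x\<close>. If that fails, contract it by passing to
    \<open>?D\<close>.\<close>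
  proof (cases "\<forall>Z\<subseteq>W. k \<le> lam ?E C (A \<union> Z)")
    case True
    then have "\<exists>X\<subseteq>W. k \<le> lam (A \<union> B) (shortened C X) A"
      using insert.prems by (intro insert.IH) auto
    then show ?thesis by blast
  next
    case False
    then obtain Z1 where Z1: "Z1 \<subseteq> W" "lam ?E C (A \<union> Z1) < k" by (meson not_le)
    let ?D = "shortened C {x}"
    show ?thesis
    proof (cases "\<forall>Z\<subseteq>W. k \<le> lam ?E ?D (A \<union> Z)")
      case True
      then have "\<exists>X\<subseteq>W. k \<le> lam (A \<union> B) (shortened ?D X) A"
        using insert.IH[OF insert.prems(1-3) _ shortened_fcode[OF C], of "{x}"] insert.prems(4)
        by simp
      then obtain X where "X \<subseteq> W" "k \<le> lam (A \<union> B) (shortened ?D X) A" by blast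
      then show ?thesis by (intro exI[of _ "insert x X"]) (auto simp: shortened_shortened)
    next
      case False
      then obtain Z2 where Z2: "Z2 \<subseteq> W" "lam ?E ?D (A \<union> Z2) < k" by (meson not_le)
      let ?P = "A \<union> Z1" and ?Q = "A \<union> Z2"
      let ?P' = "?E - ?P" and ?Q' = "?E - ?Q"
      let ?r = "crank C" and ?Ex = "insert x ?E"
      have f: "finite ?P" "finite ?Q" "finite ?P'" "finite ?Q'" "finite ?Ex"
        using E Z1 Z2 finite_subset[OF Z1(1)] finite_subset[OF Z2(1)] insert.prems(1) insert.hyps by auto
      have sub: "?P \<subseteq> ?E" "?Q \<subseteq> ?E" using Z1 Z2 by auto
      have D: "?r (insert x Z) = crank ?D Z + ?r {x}" if "finite Z" for Z
        using crank_shortened[OF C _ that, of "{x}"] by simp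
      have i1: "?r ?P + ?r ?P' + 1 \<le> k + ?r ?E"
        using lam_add[OF C E sub(1)] Z1 by simp
      have i2: "?r (insert x ?Q) + ?r (insert x ?Q') + 1 \<le> k + ?r ?Ex + ?r {x}"
        using lam_add[OF shortened_fcode[OF C] E sub(2), of "{x}"] Z2 D[OF E] D[OF f(2)] D[OF f(4)]
        by simp
      \<comment> \<open>Uncross \<open>?P\<close> with \<open>insert x ?Q\<close>, and likewise the
        complements. By \<open>e1\<close> to \<open>e4\<close> the results are the sides of the
        separations given by \<open>Z1 \<inter> Z2\<close> and by
        \<open>insert x (Z1 \<union> Z2)\<close>, to which the hypothesis on subsets of
        \<open>insert x W\<close> applies.\<close>
      have s1: "?r (?P \<union> insert x ?Q) + ?r (?P \<inter> insert x ?Q) \<le> ?r ?P + ?r (insert x ?Q)"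
        by (rule crank_submodular[OF C f(1)]) (use f(2) in simp)
      have s2: "?r (?P' \<union> insert x ?Q') + ?r (?P' \<inter> insert x ?Q') \<le> ?r ?P' + ?r (insert x ?Q')"
        by (rule crank_submodular[OF C f(3)]) (use f(4) in simp)
      have ex: "A \<union> insert x W \<union> B = ?Ex" by auto
      have kk: "k + ?r ?Ex \<le> ?r (A \<union> Z) + ?r (?Ex - (A \<union> Z))" if "Z \<subseteq> insert x W" for Z
      proof -
        have "A \<union> Z \<subseteq> ?Ex" using that by auto
        then show ?thesis
          using insert.prems(6)[OF that] lam_add[OF C f(5), of "A \<union> Z"] unfolding ex by linarith
      qed
      have k1: "k + ?r ?Ex \<le> ?r (A \<union> (Z1 \<inter> Z2)) + ?r (?Ex - (A \<union> (Z1 \<inter> Z2)))"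
        by (rule kk) (use Z1 in auto)
      have k2: "k + ?r ?Ex \<le> ?r (A \<union> insert x (Z1 \<union> Z2)) + ?r (?Ex - (A \<union> insert x (Z1 \<union> Z2)))"
        by (rule kk) (use Z1 Z2 in auto)
      have dA: "A \<inter> B = {}" "W \<inter> A = {}" "W \<inter> B = {}" "x \<notin> A" "x \<notin> B" "x \<notin> W"
        using insert.prems(3,4) insert.hyps(2) by auto
      have e1: "?P \<union> insert x ?Q = A \<union> insert x (Z1 \<union> Z2)" by auto
      have e2: "?P \<inter> insert x ?Q = A \<union> (Z1 \<inter> Z2)" using Z1 dA by auto
      have e3: "?P' \<union> insert x ?Q' = ?Ex - (A \<union> (Z1 \<inter> Z2))" using Z1 Z2 dA by blast
      have e4: "?P' \<inter> insert x ?Q' = ?Ex - (A \<union> insert x (Z1 \<union> Z2))" using Z1 Z2 dA by blast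
      have "?r {x} \<le> 1" using crank_le_card[of "{x}" C] fcode_zero[OF C] by fastforce
      moreover have "?r ?E \<le> ?r ?Ex" using crank_mono[OF f(5), of ?E C] fcode_zero[OF C] by blast
      ultimately show ?thesis using i1 i2 s1 s2 k1 k2 unfolding e1 e2 e3 e4 by linarith
    qed
  qed
qed

section \<open>States at a cut\<close>

text \<open>\<open>cong_at E C A\<close> is congruence modulo the codewords that split into a codeword vanishing off \<open>A\<close>
  and one vanishing on \<open>A\<close>; its classes are the states of the trellis at the cut \<open>A\<close>.\<close>

definition cong_at :: "'e set \<Rightarrow> ('e \<Rightarrow> 'f) set \<Rightarrow> 'e set \<Rightarrow> ('e \<Rightarrow> 'f) \<Rightarrow> ('e \<Rightarrow> 'f) \<Rightarrow> bool" where
  "cong_at E C A c c' \<longleftrightarrow> (\<exists>d\<in>C. (\<forall>e\<in>A. d e = c e) \<and> (\<forall>e\<in>E - A. d e = c' e))"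

definition split_part :: "'e set \<Rightarrow> ('e \<Rightarrow> 'f::zero) set \<Rightarrow> 'e set \<Rightarrow> ('e \<Rightarrow> 'f) set" where
  "split_part E C A = {c \<in> C. cong_at E C A c (\<lambda>_. 0)}"

lemma cong_at_iff_diff:
  assumes C: "fcode C" and c: "c \<in> C" "c' \<in> C"
  shows "cong_at E C A c c' \<longleftrightarrow> (\<lambda>e. c e - c' e) \<in> split_part E C A"
proof
  assume "cong_at E C A c c'"
  then obtain d where d: "d \<in> C" "\<forall>e\<in>A. d e = c e" "\<forall>e\<in>E - A. d e = c' e"
    unfolding cong_at_def by blast
  show "(\<lambda>e. c e - c' e) \<in> split_part E C A"
    unfolding split_part_def cong_at_def mem_Collect_eq
    by (intro conjI bexI[of _ "\<lambda>e. d e - c' e"] fcode_diff[OF C]) (use c d in auto)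
next
  assume "(\<lambda>e. c e - c' e) \<in> split_part E C A"
  then obtain d where d: "d \<in> C" "\<forall>e\<in>A. d e = c e - c' e" "\<forall>e\<in>E - A. d e = 0"
    unfolding split_part_def cong_at_def by blast
  show "cong_at E C A c c'" unfolding cong_at_def
    by (intro bexI[of _ "\<lambda>e. d e + c' e"] fcode_add[OF C]) (use c d in auto)
qed

lemma split_part_fcode:
  assumes C: "fcode C"
  shows "fcode (split_part E C A)"
  unfolding fcode_def
proof (intro conjI ballI allI)
  show "finite (split_part E C A)" using fcode_finite[OF C] unfolding split_part_def by simp
  show "(\<lambda>_. 0) \<in> split_part E C A" using fcode_zero[OF C] unfolding split_part_def cong_at_def by auto
next
  fix c d assume "c \<in> split_part E C A" "d \<in> split_part E C A"
  then obtain c' d' where *: "c \<in> C" "d \<in> C" "c' \<in> C" "d' \<in> C" "\<forall>e\<in>A. c' e = c e"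
    "\<forall>e\<in>E - A. c' e = 0" "\<forall>e\<in>A. d' e = d e" "\<forall>e\<in>E - A. d' e = 0"
    unfolding split_part_def cong_at_def by blast
  show "(\<lambda>e. c e + d e) \<in> split_part E C A"
    unfolding split_part_def cong_at_def mem_Collect_eq
    by (intro conjI bexI[of _ "\<lambda>e. c' e + d' e"] fcode_add[OF C]) (use * in auto)
next
  fix a c assume "c \<in> split_part E C A"
  then obtain c' where *: "c \<in> C" "c' \<in> C" "\<forall>e\<in>A. c' e = c e" "\<forall>e\<in>E - A. c' e = 0"
    unfolding split_part_def cong_at_def by blast
  show "(\<lambda>e. a * c e) \<in> split_part E C A"
    unfolding split_part_def cong_at_def mem_Collect_eq
    by (intro conjI bexI[of _ "\<lambda>e. a * c' e"] fcode_scale[OF C]) (use * in auto)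
qed

text \<open>The words congruent to 0 are counted through their projection to \<open>A\<close>, which
  is that of the words vanishing on \<open>E - A\<close>, and through the words vanishing on
  \<open>A\<close>. Dividing \<open>card C\<close> by this number leaves the exponent r(A) + r(E -
  A) - r(E).\<close>

lemma card_states:
  fixes C :: "('e \<Rightarrow> 'f::{field,finite}) set"
  assumes C: "fcode C" and E: "finite E" and A: "A \<subseteq> E"
    and \<tau>: "\<And>c c'. c \<in> C \<Longrightarrow> c' \<in> C \<Longrightarrow> \<tau> c = \<tau> c' \<longleftrightarrow> cong_at E C A c c'"
  shows "card (\<tau> ` C) = CARD('f) ^ lam E C A"
proof -
  let ?q = "CARD('f)" and ?H = "split_part E C A" and ?S = "shortened C (E - A)"
  have fin: "finite A" "finite (E - A)" using E A finite_subset by auto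
  have H: "fcode ?H" using split_part_fcode[OF C] .
  have sh: "shortened ?H A = shortened C A"
    using fcode_zero[OF C] unfolding shortened_def split_part_def cong_at_def by auto
  have rs: "restr A ` ?H = restr A ` ?S"
  proof
    show "restr A ` ?H \<subseteq> restr A ` ?S"
    proof
      fix y assume "y \<in> restr A ` ?H"
      then obtain c d where "c \<in> C" "y = restr A c" "d \<in> C" "\<forall>e\<in>A. d e = c e" "\<forall>e\<in>E - A. d e = 0"
        unfolding split_part_def cong_at_def by blast
      then have "y = restr A d" "d \<in> ?S" by (auto simp: restr_eq_iff shortened_def)
      then show "y \<in> restr A ` ?S" by blast
    qed
    show "restr A ` ?S \<subseteq> restr A ` ?H"
      unfolding split_part_def cong_at_def shortened_def by (intro image_mono) auto
  qed
  have "card C = card (\<tau> ` C) * card ?H"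
    by (rule card_fibres[OF C]) (auto simp: split_part_def[of E C A] \<tau> cong_at_iff_diff[OF C])
  moreover have "card ?H = ?q ^ crank ?S A * card (shortened C A)"
    using card_restr_shortened[OF H, of A] sh rs card_restr[OF shortened_fcode[OF C] fin(1), of "E - A"]
    by simp
  moreover have "card C = ?q ^ crank C A * card (shortened C A)"
    using card_eq_crank_shortened[OF C fin(1)] .
  ultimately have eq: "card (\<tau> ` C) * ?q ^ crank ?S A = ?q ^ crank C A"
    using shortened_pos[OF C, of A] by simp
  have "(E - A) \<union> A = E" using A by auto
  then have "crank C E = crank ?S A + crank C (E - A)"
    using crank_shortened[OF C fin(2) fin(1)] by simp
  then have "crank C A = lam E C A + crank ?S A" using lam_add[OF C E A] by simp
  then have "card (\<tau> ` C) * ?q ^ crank ?S A = ?q ^ lam E C A * ?q ^ crank ?S A"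
    using eq by (simp add: power_add)
  then show ?thesis by simp
qed

text \<open>States are numbered instead of being kept as classes so that sections of different codes
  become letters of one alphabet, finite for bounded connectivity. A cut has many labellings; this
  freedom is used in \<open>linked_labelling\<close>.\<close>

definition labelling :: "'e set \<Rightarrow> ('e \<Rightarrow> 'f) set \<Rightarrow> 'e set \<Rightarrow> (('e \<Rightarrow> 'f) \<Rightarrow> nat) \<Rightarrow> bool" where
  "labelling E C A \<tau> \<longleftrightarrow> \<tau> ` C = {..<CARD('f) ^ lam E C A} \<and>
     (\<forall>c\<in>C. \<forall>c'\<in>C. \<tau> c = \<tau> c' \<longleftrightarrow> cong_at E C A c c')"

lemma labelling_exists:
  fixes C :: "('e \<Rightarrow> 'f::{field,finite}) set"
  assumes C: "fcode C" and E: "finite E" and A: "A \<subseteq> E"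
  shows "\<exists>\<tau>. labelling E C A \<tau>"
proof -
  let ?H = "split_part E C A"
  define \<sigma> where "\<sigma> c = {c' \<in> C. (\<lambda>e. c e - c' e) \<in> ?H}" for c
  have H: "fcode ?H" using split_part_fcode[OF C] .
  have sub: "\<sigma> c \<subseteq> \<sigma> c'" if "c \<in> C" "c' \<in> C" "(\<lambda>e. c' e - c e) \<in> ?H" for c c'
  proof
    fix d assume "d \<in> \<sigma> c"
    then have "d \<in> C" "(\<lambda>e. c e - d e) \<in> ?H" unfolding \<sigma>_def by auto
    then show "d \<in> \<sigma> c'" unfolding \<sigma>_def using fcode_add[OF H that(3)] by fastforce
  qed
  have sym: "(\<lambda>e. c' e - c e) \<in> ?H" if "(\<lambda>e. c e - c' e) \<in> ?H" for c c'
    using fcode_scale[OF H that, of "- 1"] by simp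
  have \<sigma>: "\<sigma> c = \<sigma> c' \<longleftrightarrow> cong_at E C A c c'" if c: "c \<in> C" "c' \<in> C" for c c'
  proof
    assume eq: "\<sigma> c = \<sigma> c'"
    have "c' \<in> \<sigma> c'" unfolding \<sigma>_def using c fcode_zero[OF H] by simp
    then have "(\<lambda>e. c e - c' e) \<in> ?H" using eq unfolding \<sigma>_def by blast
    then show "cong_at E C A c c'" using cong_at_iff_diff[OF C c] by blast
  next
    assume "cong_at E C A c c'"
    then have "(\<lambda>e. c e - c' e) \<in> ?H" using cong_at_iff_diff[OF C c] by blast
    then show "\<sigma> c = \<sigma> c'" using sub[OF c sym] sub[OF c(2,1)] by blast
  qed
  obtain h where h: "bij_betw h (\<sigma> ` C) {0..<card (\<sigma> ` C)}"
    using ex_bij_betw_finite_nat[of "\<sigma> ` C"] fcode_finite[OF C] by blast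
  have "card (\<sigma> ` C) = CARD('f) ^ lam E C A" using card_states[OF C E A \<sigma>] .
  then have "(h \<circ> \<sigma>) ` C = {..<CARD('f) ^ lam E C A}"
    using h unfolding bij_betw_def by (auto simp: image_comp atLeast0LessThan)
  moreover have "(h \<circ> \<sigma>) c = (h \<circ> \<sigma>) c' \<longleftrightarrow> cong_at E C A c c'" if "c \<in> C" "c' \<in> C" for c c'
    using h that \<sigma>[OF that] unfolding bij_betw_def by (auto dest: inj_onD)
  ultimately show ?thesis unfolding labelling_def by blast
qed

lemma factor_card_eq:
  assumes D: "finite D" and fac: "\<forall>c\<in>D. \<forall>c'\<in>D. \<tau> c = \<tau> c' \<longrightarrow> \<sigma> c = \<sigma> c'"
    and le: "card (\<tau> ` D) \<le> card (\<sigma> ` D)" and c: "c \<in> D" "c' \<in> D" "\<sigma> c = \<sigma> c'"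
  shows "\<tau> c = \<tau> c'"
proof -
  define g where "g s = \<sigma> (SOME c. c \<in> D \<and> \<tau> c = s)" for s
  have g: "g (\<tau> d) = \<sigma> d" if d: "d \<in> D" for d
  proof -
    have "(SOME c. c \<in> D \<and> \<tau> c = \<tau> d) \<in> D \<and> \<tau> (SOME c. c \<in> D \<and> \<tau> c = \<tau> d) = \<tau> d"
      by (rule someI[of _ d]) (use d in simp)
    then show ?thesis unfolding g_def using fac d by blast
  qed
  have im: "g ` \<tau> ` D = \<sigma> ` D" using g by (auto simp: image_comp intro!: image_cong)
  have "card (g ` \<tau> ` D) = card (\<tau> ` D)"
    using le card_image_le[of "\<tau> ` D" g] D unfolding im by simp
  then have "inj_on g (\<tau> ` D)" using D by (intro eq_card_imp_inj_on) auto
  then show ?thesis using g c by (metis imageI inj_onD)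
qed

text \<open>On \<open>D\<close> the map \<open>\<sigma>\<close> factors through
  \<open>\<tau>\<close>, so it has at most as many values there as \<open>\<tau>\<close> has on
  \<open>D\<close>, hence on \<open>C\<close>. The assumed reverse inequality forces equality
  throughout: the factor map is injective, and \<open>D\<close> meets every class of
  \<open>\<tau>\<close>.\<close>

lemma factor_labels:
  assumes C: "finite C" and DC: "D \<subseteq> C"
    and fac: "\<forall>c\<in>D. \<forall>c'\<in>D. \<tau> c = \<tau> c' \<longrightarrow> \<sigma> c = \<sigma> c'"
    and le: "card (\<tau> ` C) \<le> card (\<sigma> ` D)"
  shows "\<tau> ` D = \<tau> ` C" "\<And>c c'. c \<in> D \<Longrightarrow> c' \<in> D \<Longrightarrow> \<tau> c = \<tau> c' \<longleftrightarrow> \<sigma> c = \<sigma> c'"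
proof -
  have D: "finite D" using C DC finite_subset by blast
  have sub: "\<tau> ` D \<subseteq> \<tau> ` C" using DC by blast
  have "card (\<tau> ` D) \<le> card (\<tau> ` C)" using card_mono[OF _ sub] C by blast
  then have le': "card (\<tau> ` D) \<le> card (\<sigma> ` D)" using le by simp
  show "\<tau> c = \<tau> c' \<longleftrightarrow> \<sigma> c = \<sigma> c'" if "c \<in> D" "c' \<in> D" for c c'
    using fac that factor_card_eq[OF D fac le' that] by blast
  have "\<sigma> ` D = (\<lambda>s. \<sigma> (SOME c. c \<in> D \<and> \<tau> c = s)) ` \<tau> ` D"
  proof -
    have "\<sigma> (SOME c. c \<in> D \<and> \<tau> c = \<tau> d) = \<sigma> d" if d: "d \<in> D" for d
    proof -
      have "(SOME c. c \<in> D \<and> \<tau> c = \<tau> d) \<in> D \<and> \<tau> (SOME c. c \<in> D \<and> \<tau> c = \<tau> d) = \<tau> d"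
        by (rule someI[of _ d]) (use d in simp)
      then show ?thesis using fac d by blast
    qed
    then show ?thesis by (auto simp: image_comp intro!: image_cong)
  qed
  then have "card (\<sigma> ` D) \<le> card (\<tau> ` D)" using D card_image_le[of "\<tau> ` D"] by simp
  then have "card (\<tau> ` D) = card (\<tau> ` C)" using le card_mono[OF _ sub] C by simp
  then show "\<tau> ` D = \<tau> ` C" using card_subset_eq[OF _ sub] C by simp
qed

text \<open>Let \<open>D\<close> be the code obtained by linking. Its states at \<open>A\<close> are a quotient both of the states of \<open>C\<close> at
  \<open>A\<close> and of those at \<open>A'\<close> that \<open>D\<close> meets; as all three sets have \<open>q^k\<close> elements, they correspond.\<close>

lemma linked_labelling:
  fixes C :: "('e \<Rightarrow> 'f::{field,finite}) set"
  assumes C: "fcode C" and E: "finite E" and A: "A \<subseteq> A'" "A' \<subseteq> E"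
    and k: "lam E C A = k" "lam E C A' = k"
    and between: "\<And>Z. A \<subseteq> Z \<Longrightarrow> Z \<subseteq> A' \<Longrightarrow> k \<le> lam E C Z"
    and \<tau>: "labelling E C A \<tau>"
  shows "\<exists>X \<tau>'. X \<subseteq> A' - A \<and> labelling E C A' \<tau>' \<and> (\<forall>c\<in>shortened C X. \<tau>' c = \<tau> c) \<and>
     \<tau> ` shortened C X = {..<CARD('f) ^ k}"
proof -
  let ?W = "A' - A" and ?B = "E - A'"
  have fin: "finite ?W" "finite A" "finite ?B" 
    using E finite_subset[OF A(2) E] finite_subset[OF A(1) finite_subset[OF A(2) E]] by auto
  have un: "A \<union> ?W \<union> ?B = E" using A by auto
  have "\<exists>X\<subseteq>?W. k \<le> lam (A \<union> ?B) (shortened C X) A"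
  proof (rule linking[OF fin _ _ C])
    fix Z assume "Z \<subseteq> ?W"
    then show "k \<le> lam (A \<union> ?W \<union> ?B) C (A \<union> Z)"
      unfolding un using A(1) by (intro between) auto
  qed (use A in auto)
  then obtain X where X: "X \<subseteq> ?W" "k \<le> lam (A \<union> ?B) (shortened C X) A" by blast
  let ?D = "shortened C X" and ?E' = "A \<union> ?B"
  have D: "fcode ?D" "?D \<subseteq> C" using shortened_fcode[OF C] by (auto simp: shortened_def)
  obtain \<sigma> where \<sigma>: "labelling ?E' ?D A \<sigma>" using labelling_exists[OF D(1), of ?E' A] fin by auto
  obtain \<tau>0 where \<tau>0: "labelling E C A' \<tau>0" using labelling_exists[OF C E A(2)] by blast
  have q: "0 < CARD('f)" using card_field_gt_1[where 'f='f] by simp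
  have big: "CARD('f) ^ k \<le> card (\<sigma> ` ?D)"
    using \<sigma> X(2) q unfolding labelling_def by (simp add: power_increasing)
  \<comment> \<open>Splice \<open>c\<close> and \<open>c'\<close> at \<open>A\<close>. As
    \<open>X\<close> lies outside \<open>A\<close>, the splice equals \<open>c'\<close> on
    \<open>X\<close> and vanishes there, so it stays in \<open>?D\<close>.\<close>
  have fac1: "\<forall>c\<in>?D. \<forall>c'\<in>?D. \<tau> c = \<tau> c' \<longrightarrow> \<sigma> c = \<sigma> c'"
  proof (intro ballI impI)
    fix c c' assume c: "c \<in> ?D" "c' \<in> ?D" "\<tau> c = \<tau> c'"
    obtain d where d: "d \<in> C" "\<forall>e\<in>A. d e = c e" "\<forall>e\<in>E - A. d e = c' e"
      using \<tau> c D(2) unfolding labelling_def cong_at_def by blast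
    have "d e = 0" if e: "e \<in> X" for e
    proof -
      have "e \<in> E - A" using e X(1) A by blast
      then show ?thesis using d(3) c(2) e unfolding shortened_def by auto
    qed
    then have "d \<in> ?D" using d(1) unfolding shortened_def by blast
    moreover have "\<forall>e\<in>?E' - A. d e = c' e" using d by auto
    ultimately have "cong_at ?E' ?D A c c'" using d(2) unfolding cong_at_def by blast
    then show "\<sigma> c = \<sigma> c'" using \<sigma> c unfolding labelling_def by blast
  qed
  \<comment> \<open>Now the splice is made at \<open>A'\<close>, which contains \<open>X\<close>, so
    on \<open>X\<close> it equals \<open>c\<close>, which vanishes there.\<close>
  have fac2: "\<forall>c\<in>?D. \<forall>c'\<in>?D. \<tau>0 c = \<tau>0 c' \<longrightarrow> \<sigma> c = \<sigma> c'"
  proof (intro ballI impI)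
    fix c c' assume c: "c \<in> ?D" "c' \<in> ?D" "\<tau>0 c = \<tau>0 c'"
    obtain d where d: "d \<in> C" "\<forall>e\<in>A'. d e = c e" "\<forall>e\<in>E - A'. d e = c' e"
      using \<tau>0 c D(2) unfolding labelling_def cong_at_def by blast
    have "d e = 0" if e: "e \<in> X" for e
    proof -
      have "e \<in> A'" using e X(1) by blast
      then show ?thesis using d(2) c(1) e unfolding shortened_def by auto
    qed
    then have "d \<in> ?D" using d(1) unfolding shortened_def by blast
    moreover have "\<forall>e\<in>?E' - A. d e = c' e" using d by auto
    moreover have "\<forall>e\<in>A. d e = c e" using d A by auto
    ultimately have "cong_at ?E' ?D A c c'" unfolding cong_at_def by blast
    then show "\<sigma> c = \<sigma> c'" using \<sigma> c unfolding labelling_def by blast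
  qed
  have c1: "card (\<tau> ` C) \<le> card (\<sigma> ` ?D)" using \<tau> k(1) big unfolding labelling_def by simp
  have c2: "card (\<tau>0 ` C) \<le> card (\<sigma> ` ?D)" using \<tau>0 k(2) big unfolding labelling_def by simp
  note f1 = factor_labels[OF fcode_finite[OF C] D(2) fac1 c1]
  note f2 = factor_labels[OF fcode_finite[OF C] D(2) fac2 c2]
  have same: "\<tau> c = \<tau> c' \<longleftrightarrow> \<tau>0 c = \<tau>0 c'" if "c \<in> ?D" "c' \<in> ?D" for c c'
    using f1(2)[OF that] f2(2)[OF that] by simp
  \<comment> \<open>By \<open>f2\<close> every state at \<open>A'\<close> contains a word of
    \<open>?D\<close>. The state takes over the number that this word has under
    \<open>\<tau>\<close>; \<open>same\<close> makes this independent of the choice.\<close>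
  define rep where "rep c = (SOME d. d \<in> ?D \<and> \<tau>0 d = \<tau>0 c)" for c
  have rep: "rep c \<in> ?D" "\<tau>0 (rep c) = \<tau>0 c" if "c \<in> C" for c
  proof -
    have "\<tau>0 c \<in> \<tau>0 ` ?D" using f2(1) that by blast
    then have "\<exists>d. d \<in> ?D \<and> \<tau>0 d = \<tau>0 c" by (metis imageE)
    then have "rep c \<in> ?D \<and> \<tau>0 (rep c) = \<tau>0 c" unfolding rep_def by (rule someI_ex)
    then show "rep c \<in> ?D" "\<tau>0 (rep c) = \<tau>0 c" by auto
  qed
  define \<tau>' where "\<tau>' c = \<tau> (rep c)" for c
  have on_D: "\<tau>' c = \<tau> c" if "c \<in> ?D" for c
    using same[OF rep(1) that] rep(2)[of c] that D(2) unfolding \<tau>'_def by blast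
  have tD: "\<tau> ` ?D = {..<CARD('f) ^ k}" using f1(1) \<tau> k(1) unfolding labelling_def by simp
  have "\<tau>' ` C = {..<CARD('f) ^ k}"
  proof
    show "\<tau>' ` C \<subseteq> {..<CARD('f) ^ k}" using rep(1) unfolding \<tau>'_def tD[symmetric] by blast
    show "{..<CARD('f) ^ k} \<subseteq> \<tau>' ` C"
      unfolding tD[symmetric] using on_D D(2) by (metis image_mono image_cong)
  qed
  moreover have "\<tau>' c = \<tau>' c' \<longleftrightarrow> cong_at E C A' c c'" if "c \<in> C" "c' \<in> C" for c c'
    using same[OF rep(1)[OF that(1)] rep(1)[OF that(2)]] rep(2)[OF that(1)] rep(2)[OF that(2)] \<tau>0 that
    unfolding \<tau>'_def labelling_def by simp
  ultimately have "labelling E C A' \<tau>'" unfolding labelling_def k(2) by blast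
  then show ?thesis using X(1) on_D tD by blast
qed

section \<open>Linked orderings\<close>

fun prefix_sum :: "('e set \<Rightarrow> nat) \<Rightarrow> 'e set \<Rightarrow> 'e list \<Rightarrow> nat" where
  "prefix_sum f A [] = 0"
| "prefix_sum f A (x # xs) = f (insert x A) + prefix_sum f (insert x A) xs"

lemma prefix_sum_append:
  "prefix_sum f A (xs @ ys) = prefix_sum f A xs + prefix_sum f (A \<union> set xs) ys"
  by (induction xs arbitrary: A) auto

lemma prefix_sum_eq_sum:
  "prefix_sum f A xs = (\<Sum>l<length xs. f (A \<union> set (take (Suc l) xs)))"
  by (induction xs arbitrary: A) (simp_all add: sum.lessThan_Suc_shift del: sum.lessThan_Suc)

text \<open>When the members of \<open>Z\<close> are listed first, in unchanged order, the prefix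
  ending with the element at a former position \<open>l\<close> is the old prefix intersected with
  \<open>Z\<close> or united with it. Indexing by old positions allows the two orderings to be
  compared cut by cut.\<close>

lemma prefix_sum_filter:
  "prefix_sum f (A \<inter> Z) (filter (\<lambda>x. x \<in> Z) xs) + prefix_sum f (A \<union> Z) (filter (\<lambda>x. x \<notin> Z) xs) =
     (\<Sum>l<length xs. if xs ! l \<in> Z then f ((A \<union> set (take (Suc l) xs)) \<inter> Z)
        else f ((A \<union> set (take (Suc l) xs)) \<union> Z))"
proof (induction xs arbitrary: A)
  case (Cons x xs)
  have rhs: "(\<Sum>l<length (x # xs). if (x # xs) ! l \<in> Z then f ((A \<union> set (take (Suc l) (x # xs))) \<inter> Z)
        else f ((A \<union> set (take (Suc l) (x # xs))) \<union> Z)) =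
      (if x \<in> Z then f (insert x A \<inter> Z) else f (insert x A \<union> Z)) +
      (\<Sum>l<length xs. if xs ! l \<in> Z then f ((insert x A \<union> set (take (Suc l) xs)) \<inter> Z)
        else f ((insert x A \<union> set (take (Suc l) xs)) \<union> Z))"
    by (simp add: sum.lessThan_Suc_shift del: sum.lessThan_Suc cong: if_cong)
  show ?case unfolding rhs Cons.IH[of "insert x A", symmetric]
    by (cases "x \<in> Z") (simp_all add: insert_absorb)
qed simp

definition ordering_le :: "'e set \<Rightarrow> ('e \<Rightarrow> 'f) set \<Rightarrow> nat \<Rightarrow> 'e list \<Rightarrow> bool" where
  "ordering_le E C w es \<longleftrightarrow> distinct es \<and> set es = E \<and> (\<forall>l\<le>length es. lam E C (set (take l es)) \<le> w)"

definition linked_ordering :: "'e set \<Rightarrow> ('e \<Rightarrow> 'f) set \<Rightarrow> 'e list \<Rightarrow> bool" where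
  "linked_ordering E C es \<longleftrightarrow>
     (\<forall>i j Z. i \<le> j \<longrightarrow> j \<le> length es \<longrightarrow> set (take i es) \<subseteq> Z \<longrightarrow> Z \<subseteq> set (take j es) \<longrightarrow>
        (\<exists>l\<in>{i..j}. lam E C (set (take l es)) \<le> lam E C Z))"

lemma set_take_eq: "l \<le> length xs \<Longrightarrow> set (take l xs) = (!) xs ` {..<l}"
  by (metis nth_image atLeast0LessThan)

text \<open>In an ordering that is not linked, put the elements of a set \<open>Z\<close> of minimal connectivity between two
  cuts before the others. By submodularity no cut gets worse, and one becomes \<open>Z\<close> itself.\<close>

lemma linked_ordering_exists:
  fixes C :: "('e \<Rightarrow> 'f::{field,finite}) set"
  assumes C: "fcode C" and E: "finite E" and ex: "ordering_le E C w es0"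
  shows "\<exists>es. ordering_le E C w es \<and> linked_ordering E C es"
proof -
  let ?lm = "lam E C"
  obtain es where es: "ordering_le E C w es"
    and least: "\<And>xs. ordering_le E C w xs \<Longrightarrow> prefix_sum ?lm {} es \<le> prefix_sum ?lm {} xs"
    using ex_has_least_nat[of "ordering_le E C w" es0 "prefix_sum ?lm {}"] ex by blast
  have di: "distinct es" and se: "set es = E" using es unfolding ordering_le_def by auto
  define T where "T l = set (take l es)" for l
  have T: "T l = (!) es ` {..<l}" if "l \<le> length es" for l using set_take_eq[OF that] by (simp add: T_def)
  have Tmono: "T l \<subseteq> T m" if "l \<le> m" for l m
    unfolding T_def by (rule set_take_subset_set_take[OF that])
  have TE: "T l \<subseteq> E" for l unfolding T_def using set_take_subset[of l es] se by simp
  have Tmem: "m < l" if "es ! m \<in> T l" "m < length es" "l \<le> length es" for m l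
    using that di T[OF that(3)] by (auto simp: nth_eq_iff_index_eq)
  have Tin: "es ! m \<in> T l" if "m < l" "l \<le> length es" for m l using T that by auto
  have "linked_ordering E C es"
  proof (rule ccontr)
    assume "\<not> linked_ordering E C es"
    then obtain i j Y where ij: "i \<le> j" "j \<le> length es" and Y: "T i \<subseteq> Y" "Y \<subseteq> T j"
      and nY: "\<not> (\<exists>l\<in>{i..j}. ?lm (T l) \<le> ?lm Y)"
      unfolding linked_ordering_def T_def by blast
    have lY: "?lm Y < ?lm (T l)" if "l \<in> {i..j}" for l using nY that by (meson not_le)
    obtain Z where Z: "T i \<subseteq> Z" "Z \<subseteq> T j"
      and Zl: "\<And>Z'. T i \<subseteq> Z' \<and> Z' \<subseteq> T j \<Longrightarrow> ?lm Z \<le> ?lm Z'"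
      using ex_has_least_nat[of "\<lambda>Z. T i \<subseteq> Z \<and> Z \<subseteq> T j" Y ?lm] Y by blast
    have lZ: "?lm Z < ?lm (T l)" if "l \<in> {i..j}" for l using lY[OF that] Zl[of Y] Y by simp
    have ZE: "Z \<subseteq> E" using Z TE by blast
    let ?T' = "\<lambda>l. if es ! l \<in> Z then T (Suc l) \<inter> Z else T (Suc l) \<union> Z"
    \<comment> \<open>Within \<open>{i..j}\<close> minimality of \<open>Z\<close> bounds the
      connectivity of both union and intersection from below by that of \<open>Z\<close>, so by
      submodularity neither exceeds that of the cut. Outside this range the cut does not
      change.\<close>
    have le: "?lm (?T' l) \<le> ?lm (T (Suc l))" if l: "l < length es" for l
    proof (cases "Suc l \<in> {i..j}")
      case True
      have "T i \<subseteq> T (Suc l)" "T (Suc l) \<subseteq> T j" using True Tmono by auto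
      then have "?lm Z \<le> ?lm (T (Suc l) \<inter> Z)" "?lm Z \<le> ?lm (T (Suc l) \<union> Z)"
        using Z by (auto intro!: Zl)
      then show ?thesis using lam_submodular[OF C E TE ZE, of "Suc l"] by auto
    next
      case False
      then consider "Suc l < i" | "j < Suc l" by fastforce
      then show ?thesis
      proof cases
        case 1
        then have "T (Suc l) \<subseteq> Z" using Tmono[of "Suc l" i] Z by auto
        moreover then have "es ! l \<in> Z" using Tin[of l "Suc l"] l by auto
        ultimately show ?thesis by (simp add: Int_absorb2)
      next
        case 2
        then have "es ! l \<notin> Z" using Tmem[of l j] l ij Z by auto
        moreover have "Z \<subseteq> T (Suc l)" using Tmono[of j "Suc l"] 2 Z by auto
        ultimately show ?thesis by (simp add: Un_absorb2)
      qed
    qed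
    have "Z \<noteq> T i" using lZ[of i] ij by auto
    then have "Z \<noteq> {}" using Z by auto
    \<comment> \<open>Let \<open>m\<close> be the position of the last member of \<open>Z\<close> in
      the ordering: there the new prefix is \<open>Z\<close> itself. The cut \<open>Suc m\<close>
      lies in \<open>{i..j}\<close>, so the connectivity strictly decreases.\<close>
    define L where "L = {l. l < length es \<and> es ! l \<in> Z}"
    have Lfin: "finite L" unfolding L_def by simp
    have "L \<noteq> {}" using \<open>Z \<noteq> {}\<close> ZE se unfolding L_def by (metis (mono_tags, lifting) all_not_in_conv
        in_set_conv_nth mem_Collect_eq subsetD)
    then have mL: "Max L \<in> L" using Lfin by simp
    define m where "m = Max L"
    have m: "m < length es" "es ! m \<in> Z" using mL unfolding m_def L_def by auto
    have Zm: "Z \<subseteq> T (Suc m)"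
    proof
      fix x assume x: "x \<in> Z"
      then obtain l where l: "l < length es" "x = es ! l" using ZE se by (metis in_set_conv_nth subsetD)
      then have "l \<in> L" using x unfolding L_def by simp
      then have "l \<le> m" unfolding m_def using Lfin by simp
      then show "x \<in> T (Suc m)" using Tin[of l "Suc m"] m l by simp
    qed
    have "m < j" using Tmem[of m j] m Z ij by auto
    moreover have "\<not> Suc m \<le> i"
    proof
      assume "Suc m \<le> i"
      then have "Z \<subseteq> T i" using Zm Tmono[of "Suc m" i] by simp
      then show False using Z \<open>Z \<noteq> T i\<close> by blast
    qed
    ultimately have "?lm Z < ?lm (T (Suc m))" by (intro lZ) auto
    then have strict: "?lm (?T' m) < ?lm (T (Suc m))" using m Zm by (simp add: Int_absorb1)
    let ?xs = "filter (\<lambda>x. x \<in> Z) es @ filter (\<lambda>x. x \<notin> Z) es"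
    have Zset: "set (filter (\<lambda>x. x \<in> Z) es) = Z" using ZE se by auto
    have ps: "prefix_sum f {} ?xs = (\<Sum>l<length es. f (?T' l))" for f
      using prefix_sum_filter[of f "{}" Z es] unfolding prefix_sum_append Zset T_def
      by (simp add: if_distrib[of f] cong: if_cong)
    have ps0: "prefix_sum f {} es = (\<Sum>l<length es. f (T (Suc l)))" for f
      using prefix_sum_eq_sum[of f "{}" es] unfolding T_def by simp
    have lt: "prefix_sum ?lm {} ?xs < prefix_sum ?lm {} es"
      unfolding ps ps0 by (rule sum_strict_mono_ex1) (use le strict m in auto)
    \<comment> \<open>summing \<open>h\<close> counts the cuts wider than \<open>w\<close>\<close>
    define h :: "'e set \<Rightarrow> nat" where "h A = (if ?lm A \<le> w then 0 else 1)" for A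
    have "prefix_sum h {} ?xs \<le> prefix_sum h {} es"
      unfolding ps ps0
    proof (rule sum_mono)
      fix l assume "l \<in> {..<length es}"
      then have "?lm (?T' l) \<le> ?lm (T (Suc l))" using le by blast
      then show "h (?T' l) \<le> h (T (Suc l))" unfolding h_def by (simp only: split: if_split) auto
    qed
    also have "\<dots> = 0" unfolding ps0 h_def using es unfolding ordering_le_def T_def by simp
    finally have z: "\<forall>l<length ?xs. h (set (take (Suc l) ?xs)) = 0"
      unfolding prefix_sum_eq_sum by (simp only: le_zero_eq Un_empty_left) auto
    have "ordering_le E C w ?xs" unfolding ordering_le_def
    proof (intro conjI allI impI)
      show "distinct ?xs" using di by auto
      show "set ?xs = E" using se ZE by auto
      fix l assume l: "l \<le> length ?xs"
      show "?lm (set (take l ?xs)) \<le> w"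
      proof (cases l)
        case 0
        have "?lm (set (take 0 es)) \<le> w" using es unfolding ordering_le_def by blast
        then show ?thesis using 0 by simp
      next
        case (Suc n)
        then have "h (set (take (Suc n) ?xs)) = 0" using z l by auto
        then show ?thesis using Suc unfolding h_def by (metis zero_neq_one)
      qed
    qed
    then show False using least lt by (metis not_le)
  qed
  then show ?thesis using es by blast
qed

section \<open>Higman's lemma\<close>

definition wqo_on :: "('a \<Rightarrow> 'a \<Rightarrow> bool) \<Rightarrow> 'a set \<Rightarrow> bool" where
  "wqo_on P A \<longleftrightarrow> (\<forall>f::nat \<Rightarrow> 'a. (\<forall>i. f i \<in> A) \<longrightarrow> (\<exists>i j. i < j \<and> P (f i) (f j)))"

text \<open>Ramsey's theorem for pairs, coloured by whether \<open>P\<close> holds: a homogeneous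
  set of the other colour would be a sequence without a good pair. \<open>Min\<close> and
  \<open>Max\<close> recover the order of an unordered pair.\<close>

lemma wqo_on_subseq:
  assumes wqo: "wqo_on P A" and f: "\<And>i. f i \<in> A"
  shows "\<exists>\<phi> :: nat \<Rightarrow> nat. strict_mono \<phi> \<and> (\<forall>i j. i < j \<longrightarrow> P (f (\<phi> i)) (f (\<phi> j)))"
proof -
  define col :: "nat set \<Rightarrow> nat" where "col S = (if P (f (Min S)) (f (Max S)) then 0 else 1)" for S
  have "\<exists>Y t. Y \<subseteq> UNIV \<and> infinite Y \<and> t < 2 \<and> (\<forall>x\<in>Y. \<forall>y\<in>Y. x \<noteq> y \<longrightarrow> col {x, y} = t)"
    by (rule Ramsey2) (auto simp: col_def)
  then obtain Y t where Y: "infinite Y" and t: "\<forall>x\<in>Y. \<forall>y\<in>Y. x \<noteq> y \<longrightarrow> col {x, y} = t" by blast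
  let ?\<phi> = "enumerate Y"
  have mono: "strict_mono ?\<phi>" using strict_mono_enumerate[OF Y] .
  have col: "col {?\<phi> i, ?\<phi> j} = (if P (f (?\<phi> i)) (f (?\<phi> j)) then 0 else 1)" if "i < j" for i j
    using strict_monoD[OF mono that] unfolding col_def by simp
  have inY: "?\<phi> i \<in> Y" for i using enumerate_in_set[OF Y] .
  have tt: "col {?\<phi> i, ?\<phi> j} = t" if "i < j" for i j
    using t inY strict_monoD[OF mono that] by auto
  obtain i j where "i < j" "P (f (?\<phi> i)) (f (?\<phi> j))"
    using wqo f unfolding wqo_on_def by (elim allE[of _ "\<lambda>i. f (?\<phi> i)"]) auto
  then have "t = 0" using tt col by metis
  then have "P (f (?\<phi> i)) (f (?\<phi> j))" if "i < j" for i j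
    using tt[OF that] col[OF that] by (metis zero_neq_one)
  with mono show ?thesis by blast
qed

lemma wqo_on_finite:
  assumes "finite A"
  shows "wqo_on (=) A"
  unfolding wqo_on_def
proof (intro allI impI)
  fix f :: "nat \<Rightarrow> 'a" assume f: "\<forall>i. f i \<in> A"
  then have "finite (range f)" using assms finite_subset by (metis image_subset_iff)
  then have "\<not> inj f" using finite_imageD[of f UNIV] by auto
  then obtain i j where "i \<noteq> j" "f i = f j" unfolding inj_def by blast
  then show "\<exists>i j. i < j \<and> f i = f j" by (metis nat_neq_iff)
qed

definition bad_seq :: "('a \<Rightarrow> 'a \<Rightarrow> bool) \<Rightarrow> 'a set \<Rightarrow> (nat \<Rightarrow> 'a) \<Rightarrow> bool" where
  "bad_seq P A f \<longleftrightarrow> (\<forall>i. f i \<in> A) \<and> (\<forall>i j. i < j \<longrightarrow> \<not> P (f i) (f j))"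

text \<open>\<open>F (Suc n)\<close> keeps the first \<open>n\<close> entries of \<open>F n\<close>
  and makes entry \<open>n\<close> as small as possible among bad sequences. Entry \<open>n\<close>
  never changes afterwards, so the diagonal is again bad and is minimal at every entry.\<close>

lemma minimal_bad_seq:
  fixes sz :: "'a \<Rightarrow> nat"
  assumes "bad_seq P A f0"
  shows "\<exists>m. bad_seq P A m \<and>
    (\<forall>n h. bad_seq P A h \<longrightarrow> (\<forall>i<n. h i = m i) \<longrightarrow> sz (m n) \<le> sz (h n))"
proof -
  define good where "good n f g \<longleftrightarrow> bad_seq P A g \<and> (\<forall>i<n. g i = f i) \<and>
    (\<forall>h. bad_seq P A h \<and> (\<forall>i<n. h i = f i) \<longrightarrow> sz (g n) \<le> sz (h n))" for n f g
  define F where "F = rec_nat f0 (\<lambda>n f. SOME g. good n f g)"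
  have step: "good n (F n) (F (Suc n))" if "bad_seq P A (F n)" for n
  proof -
    have "\<exists>g. good n (F n) g" unfolding good_def
      using ex_has_least_nat[of "\<lambda>h. bad_seq P A h \<and> (\<forall>i<n. h i = F n i)" "F n" "\<lambda>h. sz (h n)"] that
      by blast
    then show ?thesis unfolding F_def by (simp add: someI_ex)
  qed
  have bad: "bad_seq P A (F n)" for n
  proof (induction n)
    case 0 then show ?case using assms unfolding F_def by simp
  next
    case (Suc n) then show ?case using step unfolding good_def by blast
  qed
  have good: "good n (F n) (F (Suc n))" for n using step[OF bad] .
  define m where "m n = F (Suc n) n" for n
  have stable: "F k i = m i" if "Suc i \<le> k" for i k using that
  proof (induction k rule: dec_induct)
    case base show ?case unfolding m_def by simp
  next
    case (step k)
    then show ?case using good[of k] unfolding good_def by auto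
  qed
  show ?thesis
  proof (intro exI[of _ m] conjI allI impI)
    show "bad_seq P A m" unfolding bad_seq_def
    proof (intro conjI allI impI)
      show "m i \<in> A" for i using bad unfolding m_def bad_seq_def by blast
      fix i j :: nat assume "i < j"
      then have "\<not> P (F (Suc j) i) (F (Suc j) j)" using bad unfolding bad_seq_def by blast
      then show "\<not> P (m i) (m j)" using stable[of i "Suc j"] stable[of j "Suc j"] \<open>i < j\<close> by simp
    qed
    fix n h assume h: "bad_seq P A h" "\<forall>i<n. h i = m i"
    then have "\<forall>i<n. h i = F n i" using stable by auto
    then show "sz (m n) \<le> sz (h n)" using good[of n] h(1) unfolding good_def m_def by blast
  qed
qed

text \<open>The minimal bad sequence argument of Nash-Williams: along a subsequence the heads
  increase, and replacing all words from its first index on by the tails along it gives a bad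
  sequence with a shorter entry at that index.\<close>

lemma higman:
  assumes wqo: "wqo_on P A"
  shows "wqo_on (list_emb P) (lists A)"
proof (rule ccontr)
  assume "\<not> wqo_on (list_emb P) (lists A)"
  then obtain f0 where "bad_seq (list_emb P) (lists A) f0"
    unfolding wqo_on_def bad_seq_def by blast
  then obtain m where m: "bad_seq (list_emb P) (lists A) m"
    and min: "\<forall>n h. bad_seq (list_emb P) (lists A) h \<longrightarrow> (\<forall>i<n. h i = m i) \<longrightarrow>
      length (m n) \<le> length (h n)"
    using minimal_bad_seq[where sz = length] by blast
  have mA: "m n \<in> lists A" for n using m unfolding bad_seq_def by blast
  have mb: "\<not> list_emb P (m i) (m j)" if "i < j" for i j using m that unfolding bad_seq_def by blast
  have ne: "m n \<noteq> []" for n using mb[of n "Suc n"] by auto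
  define a where "a n = hd (m n)" for n
  define t where "t n = tl (m n)" for n
  have mat: "m n = a n # t n" for n using ne by (simp add: a_def t_def)
  have aA: "a n \<in> A" "t n \<in> lists A" for n using mA[of n] unfolding mat by auto
  obtain \<phi> :: "nat \<Rightarrow> nat" where \<phi>: "strict_mono \<phi>" "\<forall>i j. i < j \<longrightarrow> P (a (\<phi> i)) (a (\<phi> j))"
    using wqo_on_subseq[OF wqo, of a, OF aA(1)] by blast
  define s where "s i = (if i < \<phi> 0 then m i else t (\<phi> (i - \<phi> 0)))" for i
  have "bad_seq (list_emb P) (lists A) s" unfolding bad_seq_def
  proof (intro conjI allI impI)
    show "s i \<in> lists A" for i using mA aA unfolding s_def by simp
    fix i j :: nat assume ij: "i < j"
    show "\<not> list_emb P (s i) (s j)"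
    proof
      assume le: "list_emb P (s i) (s j)"
      consider "j < \<phi> 0" | "i < \<phi> 0" "\<phi> 0 \<le> j" | "\<phi> 0 \<le> i" using ij by linarith
      then show False
      proof cases
        case 1 then show False using le ij mb unfolding s_def by auto
      next
        case 2
        let ?x = "\<phi> (j - \<phi> 0)"
        have "list_emb P (m i) (m ?x)" using le 2 unfolding s_def mat[of ?x] by auto
        moreover have "\<phi> 0 \<le> ?x" using \<phi>(1) by (simp add: strict_mono_less_eq)
        ultimately show False using mb[of i ?x] 2 by auto
      next
        case 3
        let ?x = "\<phi> (i - \<phi> 0)" and ?y = "\<phi> (j - \<phi> 0)"
        have lt: "i - \<phi> 0 < j - \<phi> 0" using 3 ij by auto
        have "list_emb P (t ?x) (t ?y)" using le 3 ij unfolding s_def by auto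
        then have "list_emb P (m ?x) (m ?y)" unfolding mat using \<phi>(2)[rule_format, OF lt] by auto
        then show False using mb \<phi>(1) lt by (meson strict_monoD)
      qed
    qed
  qed
  then have "length (m (\<phi> 0)) \<le> length (s (\<phi> 0))" 
    using min by (elim allE[of _ "\<phi> 0"] allE[of _ s]) (auto simp: s_def)
  then show False unfolding mat[of "\<phi> 0"] by (simp add: s_def)
qed

section \<open>Words of trellis sections\<close>

text \<open>A letter \<open>(a, R, b)\<close> is a trellis section between cuts of connectivity \<open>a\<close> and \<open>b\<close>, with states
  numbered below \<open>q^a\<close> and \<open>q^b\<close>.\<close>

type_synonym 'f letter = "nat \<times> (nat \<times> 'f \<times> nat) set \<times> nat"

datatype action = Keep | Del | Con

text \<open>Sections become relations that emit the symbols of kept coordinates. Deletion forgets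
  the symbol and contraction demands that it be 0, so actions on a word turn its code into that of a
  minor.\<close>

fun act :: "action \<Rightarrow> (nat \<times> 'f::zero \<times> nat) set \<Rightarrow> (nat \<times> 'f list \<times> nat) set" where
  "act Keep R = {(s, [a], t) |s a t. (s, a, t) \<in> R}"
| "act Del R = {(s, [], t) |s a t. (s, a, t) \<in> R}"
| "act Con R = {(s, [], t) |s t. (s, 0, t) \<in> R}"

definition rcomp :: "(nat \<times> 'f list \<times> nat) set \<Rightarrow> (nat \<times> 'f list \<times> nat) set \<Rightarrow> (nat \<times> 'f list \<times> nat) set" where
  "rcomp P Q = {(s, u @ v, t) |s u m v t. (s, u, m) \<in> P \<and> (m, v, t) \<in> Q}"

fun beh :: "(action \<times> 'f::zero letter) list \<Rightarrow> (nat \<times> 'f list \<times> nat) set" where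
  "beh [] = {(s, [], s) |s. True}"
| "beh ((x, a, R, b) # ls) = rcomp (act x R) (beh ls)"

section \<open>Composition of behaviours and embeddings of words\<close>

lemma in_rcomp: "(s, w, t) \<in> rcomp P Q \<longleftrightarrow> (\<exists>u m v. w = u @ v \<and> (s, u, m) \<in> P \<and> (m, v, t) \<in> Q)"
  unfolding rcomp_def by auto

lemma comp_assoc: "rcomp (rcomp P Q) S = rcomp P (rcomp Q S)"
proof -
  have "(s, w, t) \<in> rcomp (rcomp P Q) S \<longleftrightarrow> (s, w, t) \<in> rcomp P (rcomp Q S)" for s w t
    unfolding in_rcomp by (metis append_assoc)
  then show ?thesis by auto
qed

lemma comp_beh_Nil [simp]: "rcomp P (beh []) = P" "rcomp (beh []) P = P"
  by (auto simp: in_rcomp)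

lemma beh_append: "beh (xs @ ys) = rcomp (beh xs) (beh ys)"
proof (induction xs)
  case (Cons x xs)
  then show ?case by (cases x) (simp add: comp_assoc)
qed (simp del: beh.simps)

lemma beh_single: "beh [(x, a, R, b)] = act x R"
  using comp_beh_Nil(1) by simp

text \<open>\<open>beh []\<close> is the identity on all numbers; \<open>idk k\<close> cuts it down
  to the states at a cut of connectivity \<open>k\<close> and therefore precedes behaviours that are
  to be compared.\<close>

definition idk :: "nat \<Rightarrow> (nat \<times> 'f list \<times> nat) set" where
  "idk k = {(s, [], s) |s. s < CARD('f) ^ k}"

definition wf_letter :: "'f letter \<Rightarrow> bool" where
  "wf_letter l \<longleftrightarrow> (case l of (a, R, b) \<Rightarrow> R \<subseteq> {..<CARD('f) ^ a} \<times> UNIV \<times> {..<CARD('f) ^ b})"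

abbreviation keep :: "'f letter list \<Rightarrow> (action \<times> 'f letter) list" where
  "keep \<equiv> map (Pair Keep)"

text \<open>Composite relations are compared rather than letters: a code is read off the behaviour
  of its whole word, and in this form embeddings of consecutive parts compose.\<close>

definition emb :: "nat \<Rightarrow> 'f::zero letter list \<Rightarrow> 'f letter list \<Rightarrow> bool" where
  "emb k u v \<longleftrightarrow> (\<exists>v'. map snd v' = v \<and> rcomp (idk k) (beh v') = rcomp (idk k) (beh (keep u)))"

text \<open>The same as \<open>emb k [] u\<close>: the word can be skipped at a cut of connectivity
  \<open>k\<close>.\<close>

definition linkable :: "nat \<Rightarrow> 'f::zero letter list \<Rightarrow> bool" where
  "linkable k u \<longleftrightarrow> (\<exists>u'. map snd u' = u \<and> rcomp (idk k) (beh u') = idk k)"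

text \<open>A piece of height \<open>k\<close> runs between consecutive cuts of connectivity \<open>k\<close> with wider cuts in between,
  labelled so that some deletions and contractions turn it into the identity on states.\<close>

inductive piece :: "nat \<Rightarrow> nat \<Rightarrow> 'f::zero letter list \<Rightarrow> bool" for K where
  single: "wf_letter (k, R, k) \<Longrightarrow> k \<le> K \<Longrightarrow> linkable k [(k, R, k)] \<Longrightarrow> piece K k [(k, R, k)]"
| nest: "wf_letter (k, R, Suc k) \<Longrightarrow> wf_letter (Suc k, R', k) \<Longrightarrow> Suc k \<le> K \<Longrightarrow>
    (\<And>p. p \<in> set ps \<Longrightarrow> piece K (Suc k) p) \<Longrightarrow>
    linkable k ((k, R, Suc k) # concat ps @ [(Suc k, R', k)]) \<Longrightarrow>
    piece K k ((k, R, Suc k) # concat ps @ [(Suc k, R', k)])"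

lemma in_idk: "(s, w, t) \<in> (idk k :: (nat \<times> 'f list \<times> nat) set) \<longleftrightarrow> w = [] \<and> t = s \<and> s < CARD('f) ^ k"
  unfolding idk_def by auto

lemma idk_idem: "rcomp (idk k) (idk k) = idk k"
  by (auto simp: in_rcomp in_idk)

lemma act_comp_idk:
  assumes "wf_letter (a, R, b)"
  shows "rcomp (act x R) (idk b) = act x R"
proof -
  have "t < CARD('a) ^ b" if "(s, w, t) \<in> act x R" for s w t
    using assms that unfolding wf_letter_def by (cases x) auto
  then have "(s, w, t) \<in> rcomp (act x R) (idk b) \<longleftrightarrow> (s, w, t) \<in> act x R" for s w t
    unfolding in_rcomp in_idk by auto
  then show ?thesis by auto
qed

text \<open>The last letter of a piece ends at connectivity \<open>k\<close>, so all final states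
  are numbered below \<open>q^k\<close>. This permits \<open>idk k\<close> to be inserted between
  consecutive pieces.\<close>

lemma piece_comp_idk:
  assumes "piece K k u" "map snd u' = u"
  shows "rcomp (beh u') (idk k) = beh u'"
proof -
  obtain us a R where u: "u = us @ [(a, R, k)]" "wf_letter (a, R, k)"
    using assms(1) by (cases rule: piece.cases) (auto intro: that[of "[]"] that[of "_ # _"])
  then obtain us' x where "u' = us' @ [(x, a, R, k)]"
    using assms(2) by (auto simp: map_eq_append_conv)
  then show ?thesis using act_comp_idk[OF u(2)] by (simp only: beh_append beh_single comp_assoc)
qed

text \<open>The condition \<open>id\<close> expresses that \<open>u\<close> leads back to states of
  connectivity \<open>k\<close>; inserting \<open>idk k\<close> in the middle lets the second
  embedding take over.\<close>

lemma emb_append: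
  assumes "emb k u v" "emb k u' v'" and id: "rcomp (rcomp (idk k) (beh (keep u))) (idk k) = rcomp (idk k) (beh (keep u))"
  shows "emb k (u @ u') (v @ v')"
proof -
  obtain x y where x: "map snd x = v" "rcomp (idk k) (beh x) = rcomp (idk k) (beh (keep u))"
    and y: "map snd y = v'" "rcomp (idk k) (beh y) = rcomp (idk k) (beh (keep u'))"
    using assms unfolding emb_def by blast
  have "rcomp (idk k) (beh (x @ y)) = rcomp (rcomp (idk k) (beh x)) (beh y)"
    by (simp only: beh_append comp_assoc)
  also have "\<dots> = rcomp (rcomp (rcomp (idk k) (beh (keep u))) (idk k)) (beh y)" unfolding x(2) id ..
  also have "\<dots> = rcomp (rcomp (idk k) (beh (keep u))) (rcomp (idk k) (beh (keep u')))"
    unfolding comp_assoc y(2) ..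
  also have "\<dots> = rcomp (rcomp (rcomp (idk k) (beh (keep u))) (idk k)) (beh (keep u'))"
    unfolding comp_assoc ..
  also have "\<dots> = rcomp (idk k) (beh (keep (u @ u')))" unfolding id by (simp only: beh_append comp_assoc map_append)
  finally show ?thesis unfolding emb_def using x y by (intro exI[of _ "x @ y"]) simp
qed

lemma emb_refl: "emb k u u"
  unfolding emb_def by (intro exI[of _ "keep u"]) (simp add: comp_def)

lemma emb_Nil:
  assumes "piece K k p"
  shows "emb k [] p"
proof -
  have "linkable k p" using assms by cases auto
  then show ?thesis unfolding linkable_def emb_def by (simp del: beh.simps)
qed

text \<open>\<open>list_emb\<close> may drop pieces, which can be turned into the identity by
  \<open>emb_Nil\<close>, and matches the others, which compose by
  \<open>emb_append\<close>.\<close>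

lemma emb_concat:
  assumes "list_emb (emb k) ps qs" "\<And>p. p \<in> set ps \<Longrightarrow> piece K k p" "\<And>q. q \<in> set qs \<Longrightarrow> piece K k q"
  shows "emb k (concat ps) (concat qs)"
  using assms
proof (induction rule: list_emb.induct)
  case (list_emb_Nil qs)
  then show ?case
  proof (induction qs)
    case Nil
    then show ?case using emb_refl by simp
  next
    case (Cons q qs)
    have "emb k ([] @ []) (q @ concat qs)"
      by (rule emb_append[OF emb_Nil]) (use Cons in \<open>auto simp: idk_idem simp del: beh.simps\<close>)
    then show ?case by simp
  qed
next
  case (list_emb_Cons ps qs q)
  have "emb k ([] @ concat ps) (q @ concat qs)"
    by (rule emb_append[OF emb_Nil]) (use list_emb_Cons in \<open>auto simp: idk_idem simp del: beh.simps\<close>)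
  then show ?case by simp
next
  case (list_emb_Cons2 p q ps qs)
  have "map snd (keep p) = p" by (simp add: comp_def)
  then have "rcomp (beh (keep p)) (idk k) = beh (keep p)"
    using piece_comp_idk[of K k p "keep p"] list_emb_Cons2.prems by simp
  then have "rcomp (rcomp (idk k) (beh (keep p))) (idk k) = rcomp (idk k) (beh (keep p))"
    by (simp only: comp_assoc)
  then have "emb k (p @ concat ps) (q @ concat qs)"
    by (intro emb_append) (use list_emb_Cons2 in auto)
  then show ?case by simp
qed

text \<open>The first letter ends in states of connectivity \<open>Suc k\<close>, so
  \<open>idk (Suc k)\<close> may be inserted after it, and there the inner embedding applies. Both
  outer letters are kept.\<close>

lemma emb_nest:
  assumes a: "wf_letter (k, R, Suc k)" and e: "emb (Suc k) u v"
  shows "emb k ((k, R, Suc k) # u @ [b]) ((k, R, Suc k) # v @ [b])"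
proof -
  obtain x where x: "map snd x = v" "rcomp (idk (Suc k)) (beh x) = rcomp (idk (Suc k)) (beh (keep u))"
    using e unfolding emb_def by blast
  have "rcomp (act Keep R) (beh x) = rcomp (rcomp (act Keep R) (idk (Suc k))) (beh x)"
    unfolding act_comp_idk[OF a] ..
  also have "\<dots> = rcomp (rcomp (act Keep R) (idk (Suc k))) (beh (keep u))" unfolding comp_assoc x(2) ..
  finally have "rcomp (act Keep R) (beh x) = rcomp (act Keep R) (beh (keep u))" unfolding act_comp_idk[OF a] .
  then have "beh ((Keep, (k, R, Suc k)) # x @ [(Keep, b)]) = beh (keep ((k, R, Suc k) # u @ [b]))"
    by (simp only: beh.simps beh_append list.map map_append comp_assoc[symmetric])
  then show ?thesis unfolding emb_def
    using x(1) by (intro exI[of _ "(Keep, (k, R, Suc k)) # x @ [(Keep, b)]"]) simp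
qed

text \<open>The third argument collects the finitely many choices of outermost letters; \<open>None\<close> marks a single letter.\<close>

fun decomposes :: "nat \<Rightarrow> nat \<Rightarrow> (nat \<times> 'f::zero \<times> nat) set option \<times> (nat \<times> 'f \<times> nat) set \<Rightarrow>
    'f letter list list \<Rightarrow> 'f letter list \<Rightarrow> bool" where
  "decomposes K k (None, R) ps u \<longleftrightarrow> u = [(k, R, k)]"
| "decomposes K k (Some R', R) ps u \<longleftrightarrow> u = (k, R, Suc k) # concat ps @ [(Suc k, R', k)] \<and>
     wf_letter (k, R, Suc k) \<and> (\<forall>p\<in>set ps. piece K (Suc k) p)"

text \<open>Downward induction on \<open>k\<close>, starting where \<open>k > K\<close> and there
  are no pieces. A piece is given by its outermost letters, with finitely many choices, and by a
  sequence of pieces of height \<open>Suc k\<close>, for which Higman's lemma turns the induction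
  hypothesis into a good pair.\<close>

lemma wqo_pieces: "wqo_on (emb k) {u :: 'f::{field,finite} letter list. piece K k u}"
proof (induction "Suc K - k" arbitrary: k)
  case 0
  have "\<not> piece K k u" for u :: "'f letter list" using 0 by (auto elim!: piece.cases)
  then show ?case unfolding wqo_on_def by blast
next
  case (Suc n)
  have IH: "wqo_on (emb (Suc k)) {u :: 'f letter list. piece K (Suc k) u}" using Suc by auto
  let ?q = "CARD('f)"
  let ?S = "\<lambda>a b. Pow ({..<?q ^ a} \<times> (UNIV :: 'f set) \<times> {..<?q ^ b})"
  let ?T = "insert None (Some ` ?S (Suc k) k) \<times> (?S k k \<union> ?S k (Suc k))"
  have finT: "finite ?T" by simp
  have dec: "\<exists>t ps. t \<in> ?T \<and> ps \<in> lists {u. piece K (Suc k) u} \<and> decomposes K k t ps u"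
    if "piece K k u" for u :: "'f letter list"
    using that
  proof cases
    case (single R)
    then show ?thesis
      by (intro exI[of _ "(None, R)"] exI[of _ "[]"]) (auto simp: wf_letter_def)
  next
    case (nest R R' ps)
    then show ?thesis
      by (intro exI[of _ "(Some R', R)"] exI[of _ ps]) (auto simp: wf_letter_def)
  qed
  show ?case unfolding wqo_on_def
  proof (intro allI impI)
    fix f :: "nat \<Rightarrow> 'f letter list" assume f: "\<forall>i. f i \<in> {u. piece K k u}"
    then have "\<exists>t ps. t \<in> ?T \<and> ps \<in> lists {u. piece K (Suc k) u} \<and> decomposes K k t ps (f i)" for i
      by (intro dec) simp
    then obtain t ps where t: "\<And>i. t i \<in> ?T" and ps: "\<And>i. ps i \<in> lists {u. piece K (Suc k) u}"
      and d: "\<And>i. decomposes K k (t i) (ps i) (f i)" by metis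
    \<comment> \<open>For equality on a finite set an increasing subsequence is a constant one, so
      all words along \<open>\<phi>\<close> share their outermost letters.\<close>
    obtain \<phi> :: "nat \<Rightarrow> nat" where \<phi>: "strict_mono \<phi>" and eq: "\<forall>i j. i < j \<longrightarrow> t (\<phi> i) = t (\<phi> j)"
      using wqo_on_subseq[OF wqo_on_finite[OF finT], of t, OF t] by blast
    have "\<exists>i j. i < j \<and> list_emb (emb (Suc k)) (ps (\<phi> i)) (ps (\<phi> j))"
      using higman[OF IH] ps unfolding wqo_on_def by (elim allE[of _ "\<lambda>i. ps (\<phi> i)"]) simp
    then obtain i j where ij: "i < j" "list_emb (emb (Suc k)) (ps (\<phi> i)) (ps (\<phi> j))" by blast
    let ?i = "\<phi> i" and ?j = "\<phi> j"
    have "emb k (f ?i) (f ?j)"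
    proof (cases "t ?i")
      case (Pair o' R)
      then have tj: "t ?j = (o', R)" using eq ij(1) by metis
      show ?thesis
      proof (cases o')
        case None
        then have "f ?i = f ?j" using d[of ?i] d[of ?j] tj Pair by simp
        then show ?thesis using emb_refl by metis
      next
        case (Some R')
        then have "f ?i = (k, R, Suc k) # concat (ps ?i) @ [(Suc k, R', k)]"
          "f ?j = (k, R, Suc k) # concat (ps ?j) @ [(Suc k, R', k)]" "wf_letter (k, R, Suc k)"
          using d[of ?i] d[of ?j] tj Pair by simp_all
        moreover have "emb (Suc k) (concat (ps ?i)) (concat (ps ?j))"
          by (rule emb_concat[OF ij(2)]) (use ps in auto)
        ultimately show ?thesis using emb_nest by metis
      qed
    qed
    then show "\<exists>i j. i < j \<and> emb k (f i) (f j)" using strict_monoD[OF \<phi> ij(1)] by blast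
  qed
qed

lemma wqo_concat_pieces:
  fixes ps :: "nat \<Rightarrow> 'f::{field,finite} letter list list"
  assumes "\<And>i p. p \<in> set (ps i) \<Longrightarrow> piece K k p"
  shows "\<exists>i j. i < j \<and> emb k (concat (ps i)) (concat (ps j))"
proof -
  have "\<exists>i j. i < j \<and> list_emb (emb k) (ps i) (ps j)"
    using higman[OF wqo_pieces[of k K]] assms unfolding wqo_on_def by blast
  then show ?thesis using emb_concat[of k _ _ K] assms by blast
qed

section \<open>Trellises of codes\<close>

text \<open>Moving one element across the cut raises one of the two ranks by at most 1 and lowers
  the other by at most 1. Hence a word can leave height \<open>k\<close> upwards only through
  \<open>Suc k\<close>, on which the shape of \<open>piece\<close> relies.\<close>

lemma lam_insert:
  fixes C :: "('e \<Rightarrow> 'f::{field,finite}) set"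
  assumes C: "fcode C" and E: "finite E" and A: "A \<subseteq> E" and x: "x \<in> E"
  shows "lam E C (insert x A) \<le> Suc (lam E C A)" "lam E C A \<le> Suc (lam E C (insert x A))"
proof -
  have ne: "C \<noteq> {}" using fcode_zero[OF C] by blast
  have f: "finite A" "finite (E - A)" "finite (E - insert x A)" using E A finite_subset by auto
  have step: "crank C (insert x B) \<le> Suc (crank C B)" if "finite B" for B
    using crank_subadd[OF C _ that, of "{x}"] crank_le_card[of "{x}" C] ne by simp
  have "crank C (E - A) \<le> crank C (insert x (E - insert x A))"
    using f ne by (intro crank_mono) auto
  then have 1: "crank C (E - A) \<le> Suc (crank C (E - insert x A))" using step[OF f(3)] by simp
  have 2: "crank C (E - insert x A) \<le> crank C (E - A)" using f ne by (intro crank_mono) auto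
  have 3: "crank C A \<le> crank C (insert x A)" using f ne by (intro crank_mono) auto
  have sub: "insert x A \<subseteq> E" using A x by simp
  show "lam E C (insert x A) \<le> Suc (lam E C A)" "lam E C A \<le> Suc (lam E C (insert x A))"
    using lam_add[OF C E A] lam_add[OF C E sub] 1 2 3 step[OF f(1)] by linarith+
qed

text \<open>The state of a codeword is determined by its past and, in
  \<open>labelling_eq_right\<close>, by its future; \<open>labelling_splice\<close> joins the past
  of one word to the future of another in the same state.\<close>

lemma labelling_eq_left:
  assumes "labelling E C A \<tau>" "c \<in> C" "d \<in> C" "\<forall>e\<in>A. c e = d e"
  shows "\<tau> c = \<tau> d"
proof -
  have "cong_at E C A c d" unfolding cong_at_def using assms by (intro bexI[of _ d]) auto
  then show ?thesis using assms unfolding labelling_def by blast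
qed

lemma labelling_eq_right:
  assumes "labelling E C A \<tau>" "c \<in> C" "d \<in> C" "\<forall>e\<in>E - A. c e = d e"
  shows "\<tau> c = \<tau> d"
proof -
  have "cong_at E C A c d" unfolding cong_at_def using assms by (intro bexI[of _ c]) auto
  then show ?thesis using assms unfolding labelling_def by blast
qed

lemma labelling_splice:
  assumes "labelling E C A \<tau>" "c \<in> C" "c' \<in> C" "\<tau> c = \<tau> c'"
  obtains d where "d \<in> C" "\<forall>e\<in>A. d e = c e" "\<forall>e\<in>E - A. d e = c' e"
  using assms unfolding labelling_def cong_at_def by blast

locale trellis =
  fixes E :: "'e set" and C :: "('e \<Rightarrow> 'f::{field,finite}) set" and es :: "'e list"
  assumes C: "fcode C" and E: "finite E" and di: "distinct es" and se: "set es = E"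
begin

definition cut :: "nat \<Rightarrow> 'e set" where
  "cut l = set (take l es)"

abbreviation height :: "nat \<Rightarrow> nat" where
  "height l \<equiv> lam E C (cut l)"

definition sect :: "(nat \<Rightarrow> ('e \<Rightarrow> 'f) \<Rightarrow> nat) \<Rightarrow> nat \<Rightarrow> 'f letter" where
  "sect \<tau> l = (height l, {(\<tau> l c, c (es ! l), \<tau> (Suc l) c) |c. c \<in> C}, height (Suc l))"

abbreviation word :: "(nat \<Rightarrow> ('e \<Rightarrow> 'f) \<Rightarrow> nat) \<Rightarrow> nat \<Rightarrow> nat \<Rightarrow> 'f letter list" where
  "word \<tau> i j \<equiv> map (sect \<tau>) [i..<j]"

definition labels :: "(nat \<Rightarrow> ('e \<Rightarrow> 'f) \<Rightarrow> nat) \<Rightarrow> nat \<Rightarrow> nat \<Rightarrow> bool" where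
  "labels \<tau> i j \<longleftrightarrow> (\<forall>l\<in>{i..j}. labelling E C (cut l) (\<tau> l))"

lemma cut_Suc: "l < length es \<Longrightarrow> cut (Suc l) = insert (es ! l) (cut l)"
  unfolding cut_def by (simp add: take_Suc_conv_app_nth)

lemma cut_mono: "l \<le> m \<Longrightarrow> cut l \<subseteq> cut m"
  unfolding cut_def by (rule set_take_subset_set_take)

lemma cut_subset: "cut l \<subseteq> E"
  unfolding cut_def using set_take_subset[of l es] se by simp

lemma nth_in_cut: "m < length es \<Longrightarrow> l \<le> length es \<Longrightarrow> es ! m \<in> cut l \<longleftrightarrow> m < l"
  unfolding cut_def set_take_eq using di by (auto simp: nth_eq_iff_index_eq)

lemma nth_in_E: "l < length es \<Longrightarrow> es ! l \<in> E"
  using se by auto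

lemma height_Suc:
  assumes "l < length es"
  shows "height (Suc l) \<le> Suc (height l)" "height l \<le> Suc (height (Suc l))"
  using lam_insert[OF C E cut_subset nth_in_E[OF assms]] cut_Suc[OF assms] by simp_all

lemma in_act_sect:
  "(s, w, t) \<in> act x {(\<tau> l c, c e, \<tau>' c) |c. c \<in> C} \<longleftrightarrow>
     (\<exists>c\<in>C. s = \<tau> l c \<and> w = (if x = Keep then [c e] else []) \<and> t = \<tau>' c \<and> (x = Con \<longrightarrow> c e = 0))"
  by (cases x) auto

text \<open>Every path through the trellis comes from a codeword. When a section is appended, the
  word read so far and the one used in the new section share their state at cut \<open>j\<close>;
  their splice agrees with the first before this cut and with the second after it, so it has the
  required symbols and end states.\<close>

lemma beh_word:
  assumes "i \<le> j" "j \<le> length es" "labels \<tau> i j"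
  shows "rcomp (idk (height i)) (beh (map (\<lambda>l. (\<alpha> l, sect \<tau> l)) [i..<j])) =
    {(\<tau> i c, map (\<lambda>l. c (es ! l)) (filter (\<lambda>l. \<alpha> l = Keep) [i..<j]), \<tau> j c) |c.
       c \<in> C \<and> (\<forall>l\<in>{i..<j}. \<alpha> l = Con \<longrightarrow> c (es ! l) = 0)}"
  using assms
proof (induction j rule: dec_induct)
  case base
  have im: "\<tau> i ` C = {..<CARD('f) ^ height i}" using base unfolding labels_def labelling_def by auto
  have "(s, w, t) \<in> idk (height i) \<longleftrightarrow> (\<exists>c\<in>C. s = \<tau> i c \<and> w = [] \<and> t = \<tau> i c)"
    for s t and w :: "'f list"
    using im unfolding in_idk by (metis (no_types, lifting) imageE imageI lessThan_iff)
  then show ?case by (auto simp del: beh.simps)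
next
  case (step j)
  let ?P = "\<lambda>j. {(\<tau> i c, map (\<lambda>l. c (es ! l)) (filter (\<lambda>l. \<alpha> l = Keep) [i..<j]), \<tau> j c) |c.
       c \<in> C \<and> (\<forall>l\<in>{i..<j}. \<alpha> l = Con \<longrightarrow> c (es ! l) = 0)}"
  have j: "j < length es" using step by simp
  have lab: "labelling E C (cut l) (\<tau> l)" if "i \<le> l" "l \<le> Suc j" for l
    using step.prems that unfolding labels_def by simp
  have IH: "rcomp (idk (height i)) (beh (map (\<lambda>l. (\<alpha> l, sect \<tau> l)) [i..<j])) = ?P j"
    using step by (simp add: labels_def)
  have up: "[i..<Suc j] = [i..<j] @ [j]" using step by simp
  let ?A = "act (\<alpha> j) {(\<tau> j c, c (es ! j), \<tau> (Suc j) c) |c. c \<in> C}"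
  have eq: "rcomp (idk (height i)) (beh (map (\<lambda>l. (\<alpha> l, sect \<tau> l)) [i..<Suc j])) = rcomp (?P j) ?A"
    unfolding up map_append beh_append comp_assoc[symmetric] IH by (simp add: sect_def beh_single del: beh.simps)
  have "(s, w, t) \<in> rcomp (?P j) ?A \<longleftrightarrow> (s, w, t) \<in> ?P (Suc j)" for s w t
  proof
    assume "(s, w, t) \<in> rcomp (?P j) ?A"
    then obtain c1 c2 where c1: "c1 \<in> C" "\<forall>l\<in>{i..<j}. \<alpha> l = Con \<longrightarrow> c1 (es ! l) = 0" "s = \<tau> i c1"
      and c2: "c2 \<in> C" "\<alpha> j = Con \<longrightarrow> c2 (es ! j) = 0" "t = \<tau> (Suc j) c2" and m: "\<tau> j c1 = \<tau> j c2"
      and w: "w = map (\<lambda>l. c1 (es ! l)) (filter (\<lambda>l. \<alpha> l = Keep) [i..<j]) @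
        (if \<alpha> j = Keep then [c2 (es ! j)] else [])"
      unfolding in_rcomp in_act_sect by auto
    obtain d where d: "d \<in> C" "\<forall>e\<in>cut j. d e = c1 e" "\<forall>e\<in>E - cut j. d e = c2 e"
      using labelling_splice[OF lab c1(1) c2(1) m] step by auto
    have d1: "d (es ! l) = c1 (es ! l)" if "l < j" for l using d(2) nth_in_cut[of l j] that j by auto
    have d2: "d (es ! j) = c2 (es ! j)" using d(3) nth_in_cut[of j j] j nth_in_E by auto
    have "\<tau> i d = \<tau> i c1"
      using labelling_eq_left[OF lab d(1) c1(1), of i] d(2) cut_mono[of i j] step by auto
    moreover have "\<tau> (Suc j) d = \<tau> (Suc j) c2"
      using labelling_eq_right[OF lab d(1) c2(1), of "Suc j"] d(3) cut_mono[of j "Suc j"] step by auto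
    moreover have "w = map (\<lambda>l. d (es ! l)) (filter (\<lambda>l. \<alpha> l = Keep) [i..<Suc j])"
      unfolding w up using d1 d2 by auto
    moreover have "\<forall>l\<in>{i..<Suc j}. \<alpha> l = Con \<longrightarrow> d (es ! l) = 0"
      using c1(2) c2(2) d1 d2 by (auto simp: less_Suc_eq)
    ultimately show "(s, w, t) \<in> ?P (Suc j)" using c1(3) c2(3) d(1)
      unfolding mem_Collect_eq by (intro exI[of _ d]) simp
  next
    assume "(s, w, t) \<in> ?P (Suc j)"
    then obtain c where c: "c \<in> C" "\<forall>l\<in>{i..<Suc j}. \<alpha> l = Con \<longrightarrow> c (es ! l) = 0" "s = \<tau> i c"
      "t = \<tau> (Suc j) c" "w = map (\<lambda>l. c (es ! l)) (filter (\<lambda>l. \<alpha> l = Keep) [i..<Suc j])" by blast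
    have "(s, map (\<lambda>l. c (es ! l)) (filter (\<lambda>l. \<alpha> l = Keep) [i..<j]), \<tau> j c) \<in> ?P j" using c by auto
    moreover have "(\<tau> j c, if \<alpha> j = Keep then [c (es ! j)] else [], t) \<in> ?A"
      unfolding in_act_sect using c step by auto
    moreover have "w = map (\<lambda>l. c (es ! l)) (filter (\<lambda>l. \<alpha> l = Keep) [i..<j]) @
        (if \<alpha> j = Keep then [c (es ! j)] else [])" unfolding c(5) up by simp
    ultimately show "(s, w, t) \<in> rcomp (?P j) ?A" unfolding in_rcomp by blast
  qed
  then show ?case unfolding eq by auto
qed

section \<open>Cutting the word of a code into pieces\<close>

lemma wf_sect:
  assumes "labelling E C (cut l) (\<tau> l)" "labelling E C (cut (Suc l)) (\<tau> (Suc l))"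
  shows "wf_letter (sect \<tau> l)"
  using assms unfolding wf_letter_def sect_def labelling_def by auto

text \<open>The set \<open>X\<close> provided by \<open>linked_labelling\<close> is contracted and
  the rest of the segment deleted. No symbol is emitted, equal numbers at both ends make the
  relation part of the identity, and by \<open>onto\<close> it reaches every state.\<close>

lemma linkable_word:
  assumes ij: "i \<le> j" "j \<le> length es" and lab: "labels \<tau> i j" and X: "X \<subseteq> cut j - cut i"
    and same: "\<forall>c\<in>shortened C X. \<tau> j c = \<tau> i c" and onto: "\<tau> i ` shortened C X = {..<CARD('f) ^ height i}"
  shows "linkable (height i) (word \<tau> i j)"
proof -
  let ?\<alpha> = "\<lambda>l. if es ! l \<in> X then Con else Del"
  have X': "(\<forall>l\<in>{i..<j}. ?\<alpha> l = Con \<longrightarrow> c (es ! l) = 0) \<longleftrightarrow> (\<forall>e\<in>X. c e = 0)" for c :: "'e \<Rightarrow> 'f"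
  proof
    assume *: "\<forall>l\<in>{i..<j}. ?\<alpha> l = Con \<longrightarrow> c (es ! l) = 0"
    show "\<forall>e\<in>X. c e = 0"
    proof
      fix e assume e: "e \<in> X"
      then have "e \<in> cut j" "e \<notin> cut i" using X by auto
      then obtain l where l: "l < j" "e = es ! l" unfolding cut_def set_take_eq[OF ij(2)] by auto
      then have "i \<le> l" using nth_in_cut[of l i] ij \<open>e \<notin> cut i\<close> by auto
      then show "c e = 0" using * l e by auto
    qed
  qed auto
  have "rcomp (idk (height i)) (beh (map (\<lambda>l. (?\<alpha> l, sect \<tau> l)) [i..<j])) =
      {(\<tau> i c, map (\<lambda>l. c (es ! l)) (filter (\<lambda>l. ?\<alpha> l = Keep) [i..<j]), \<tau> j c) |c.
        c \<in> C \<and> (\<forall>e\<in>X. c e = 0)}"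
    unfolding beh_word[OF ij lab] X' ..
  also have "\<dots> = {(\<tau> i c, [], \<tau> i c) |c. c \<in> shortened C X}"
  proof -
    have "filter (\<lambda>l. ?\<alpha> l = Keep) [i..<j] = []" by (simp add: filter_empty_conv)
    then show ?thesis using same by (auto simp: shortened_def)
  qed
  also have "\<dots> = (\<lambda>s. (s, [], s)) ` \<tau> i ` shortened C X" by auto
  also have "\<dots> = idk (height i)" unfolding onto idk_def by auto
  finally show ?thesis unfolding linkable_def
    by (intro exI[of _ "map (\<lambda>l. (?\<alpha> l, sect \<tau> l)) [i..<j]"]) simp
qed

lemma word_cong: "(\<And>l. l \<in> {i..j} \<Longrightarrow> \<tau> l = \<tau>' l) \<Longrightarrow> word \<tau> i j = word \<tau>' i j"
  unfolding sect_def by (intro map_cong) auto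

lemma word_append: "i \<le> j \<Longrightarrow> j \<le> k \<Longrightarrow> word \<tau> i k = word \<tau> i j @ word \<tau> j k"
  by (metis map_append le_iff_add upt_add_eq_append)

text \<open>Induction on the length of the segment, for all heights at once. The labelling
  \<open>\<sigma>\<close> of the first cut is prescribed because each later labelling at height
  \<open>k\<close> comes by linking from the one before it. The induction hypothesis is applied to
  the rest with the new labelling, and to the interior of the first piece at height
  \<open>Suc k\<close>.\<close>

lemma word_decomposes:
  assumes linked: "linked_ordering E C es" and bound: "\<And>l. l \<le> length es \<Longrightarrow> height l \<le> K"
  shows "\<lbrakk>i \<le> j; j \<le> length es; height i = k; height j = k; \<And>l. l \<in> {i..j} \<Longrightarrow> k \<le> height l;
    labelling E C (cut i) \<sigma>\<rbrakk> \<Longrightarrow>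
    \<exists>\<tau> ps. \<tau> i = \<sigma> \<and> labels \<tau> i j \<and> (\<forall>p\<in>set ps. piece K k p) \<and> word \<tau> i j = concat ps"
proof (induction "j - i" arbitrary: i j k \<sigma> rule: less_induct)
  case less
  note ij = less.prems(1,2) and hi = less.prems(3) and hj = less.prems(4) and hl = less.prems(5)
    and \<sigma> = less.prems(6)
  show ?case
  proof (cases "i = j")
    case True
    then show ?thesis using \<sigma> by (intro exI[of _ "\<lambda>_. \<sigma>"] exI[of _ "[]"]) (auto simp: labels_def)
  next
    case False
    define n where "n = (LEAST l. i < l \<and> height l = k)"
    have exn: "i < j \<and> height j = k" using False ij hj by simp
    have n: "i < n" "height n = k" using LeastI[of "\<lambda>l. i < l \<and> height l = k", OF exn] unfolding n_def by auto
    have nj: "n \<le> j" unfolding n_def by (rule Least_le) (rule exn)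
    have nn: "height l \<noteq> k" if "i < l" "l < n" for l
      using not_less_Least[of l "\<lambda>l. i < l \<and> height l = k"] that unfolding n_def by blast
    have gt: "Suc k \<le> height l" if "i < l" "l < n" for l
      using nn[OF that] hl[of l] that nj by fastforce
    have "\<exists>X \<tau>'. X \<subseteq> cut n - cut i \<and> labelling E C (cut n) \<tau>' \<and> (\<forall>c\<in>shortened C X. \<tau>' c = \<sigma> c) \<and>
      \<sigma> ` shortened C X = {..<CARD('f) ^ k}"
    proof (rule linked_labelling[OF C E _ cut_subset hi n(2) _ \<sigma>])
      show "cut i \<subseteq> cut n" using cut_mono n by simp
      fix Z assume Z: "cut i \<subseteq> Z" "Z \<subseteq> cut n"
      \<comment> \<open>Here linkedness turns the bound on the cuts of the ordering into one on
        every set between \<open>cut i\<close> and \<open>cut n\<close>.\<close>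
      have "\<exists>l\<in>{i..n}. height l \<le> lam E C Z"
        using linked Z n nj ij unfolding linked_ordering_def cut_def by auto
      then obtain l where l: "l \<in> {i..n}" "height l \<le> lam E C Z" by blast
      then show "k \<le> lam E C Z" using hl[of l] nj by auto
    qed
    then obtain X \<tau>n where X: "X \<subseteq> cut n - cut i" and \<tau>n: "labelling E C (cut n) \<tau>n"
      and same: "\<forall>c\<in>shortened C X. \<tau>n c = \<sigma> c" and onto: "\<sigma> ` shortened C X = {..<CARD('f) ^ k}" by blast
    have "\<exists>\<tau> ps. \<tau> n = \<tau>n \<and> labels \<tau> n j \<and> (\<forall>p\<in>set ps. piece K k p) \<and> word \<tau> n j = concat ps"
      using less.hyps[of j n k \<tau>n] n nj ij hj hl \<tau>n by auto
    then obtain \<tau>2 ps2 where \<tau>2: "\<tau>2 n = \<tau>n" "labels \<tau>2 n j" "\<forall>p\<in>set ps2. piece K k p"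
      "word \<tau>2 n j = concat ps2" by blast
    \<comment> \<open>Linkability is proved once for both shapes of a piece, after the labels inside
      have been fixed; hence the implication.\<close>
    have "\<exists>\<tau>. \<tau> i = \<sigma> \<and> labels \<tau> i n \<and> \<tau> n = \<tau>n \<and> (linkable k (word \<tau> i n) \<longrightarrow> piece K k (word \<tau> i n))"
    proof (cases "n = Suc i")
      case True
      let ?\<tau> = "\<lambda>l. if l \<le> i then \<sigma> else \<tau>n"
      have lab: "labels ?\<tau> i n" unfolding labels_def using True \<sigma> \<tau>n by (auto simp: le_Suc_eq)
      have "wf_letter (sect ?\<tau> i)" using True \<sigma> \<tau>n by (intro wf_sect) auto
      moreover have "sect ?\<tau> i = (k, fst (snd (sect ?\<tau> i)), k)" using True hi n by (simp add: sect_def)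
      moreover have "word ?\<tau> i n = [sect ?\<tau> i]" using True by simp
      moreover have "k \<le> K" using bound[of i] hi ij by simp
      ultimately have "linkable k (word ?\<tau> i n) \<longrightarrow> piece K k (word ?\<tau> i n)"
        using piece.single by metis
      then show ?thesis using lab True by (intro exI[of _ ?\<tau>]) auto
    next
      case False
      let ?a = "Suc i" and ?b = "n - 1"
      have ab: "?a \<le> ?b" "i < ?b" "?b < n" "Suc ?b = n" using False n by auto
      have ha: "height ?a = Suc k" using gt[of ?a] height_Suc(1)[of i] hi ab ij nj by simp
      have hb: "height ?b = Suc k" using gt[of ?b] height_Suc(2)[of ?b] n ab ij nj by simp
      \<comment> \<open>The excursion may start from any labelling, since the linking from
        \<open>i\<close> to \<open>n\<close> involves only the labels at these two cuts.\<close>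
      obtain \<sigma>a where \<sigma>a: "labelling E C (cut ?a) \<sigma>a" using labelling_exists[OF C E cut_subset] by blast
      have "\<exists>\<tau> ps. \<tau> ?a = \<sigma>a \<and> labels \<tau> ?a ?b \<and> (\<forall>p\<in>set ps. piece K (Suc k) p) \<and> word \<tau> ?a ?b = concat ps"
      proof (rule less.hyps)
        show "?b - ?a < j - i" "?b \<le> length es" using ab ij nj by linarith+
        show "Suc k \<le> height l" if "l \<in> {?a..?b}" for l using gt[of l] that ab by auto
      qed (use ab ha hb \<sigma>a in auto)
      then obtain \<tau>1 ps1 where \<tau>1: "labels \<tau>1 ?a ?b" "\<forall>p\<in>set ps1. piece K (Suc k) p"
        "word \<tau>1 ?a ?b = concat ps1" by blast
      let ?\<tau> = "\<lambda>l. if l \<le> i then \<sigma> else if l < n then \<tau>1 l else \<tau>n"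
      have lab: "labels ?\<tau> i n" unfolding labels_def
      proof
        fix l assume "l \<in> {i..n}"
        then consider "l = i" | "l \<in> {?a..?b}" | "l = n" using ab by fastforce
        then show "labelling E C (cut l) (?\<tau> l)"
          by cases (use \<sigma> \<tau>n \<tau>1(1) n ab in \<open>auto simp: labels_def\<close>)
      qed
      have "word ?\<tau> ?a ?b = concat ps1"
        unfolding \<tau>1(3)[symmetric] by (rule word_cong) (use ab in auto)
      moreover have "[i..<n] = i # [?a..<?b] @ [?b]"
        using ab by (metis append_Cons less_imp_le n(1) upt_Suc_append upt_conv_Cons)
      ultimately have w: "word ?\<tau> i n = sect ?\<tau> i # concat ps1 @ [sect ?\<tau> ?b]" by simp
      have wf: "wf_letter (sect ?\<tau> l)" if "i \<le> l" "l < n" for l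
      proof -
        have ll: "labelling E C (cut l) (?\<tau> l)" if "l \<in> {i..n}" for l
          using lab that unfolding labels_def by (rule bspec)
        show ?thesis by (rule wf_sect) (rule ll, use that in simp)+
      qed
      have l1: "sect ?\<tau> i = (k, fst (snd (sect ?\<tau> i)), Suc k)" using hi ha by (simp add: sect_def)
      have l2: "sect ?\<tau> ?b = (Suc k, fst (snd (sect ?\<tau> ?b)), k)" using hb n ab by (simp add: sect_def)
      have "Suc k \<le> K" using bound[of ?a] ha ab ij nj by simp
      then have "linkable k (word ?\<tau> i n) \<longrightarrow> piece K k (word ?\<tau> i n)"
        using piece.nest[of k "fst (snd (sect ?\<tau> i))" "fst (snd (sect ?\<tau> ?b))" K ps1] \<tau>1(2)
          wf[of i] wf[of ?b] ab n(1)
        unfolding w l1[symmetric] l2[symmetric] by auto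
      then show ?thesis using lab n by (intro exI[of _ ?\<tau>]) auto
    qed
    then obtain \<tau>1 where \<tau>1: "\<tau>1 i = \<sigma>" "labels \<tau>1 i n" "\<tau>1 n = \<tau>n"
      "linkable k (word \<tau>1 i n) \<longrightarrow> piece K k (word \<tau>1 i n)" by blast
    have "linkable (height i) (word \<tau>1 i n)"
      by (rule linkable_word[OF _ _ \<tau>1(2) X]) (use n nj ij same onto \<tau>1 hi in auto)
    then have pc: "piece K k (word \<tau>1 i n)" using \<tau>1(4) hi by simp
    let ?\<tau> = "\<lambda>l. if l \<le> n then \<tau>1 l else \<tau>2 l"
    have "labels ?\<tau> i j" using \<tau>1(2) \<tau>2(2) unfolding labels_def by auto
    moreover have "word ?\<tau> i j = concat (word \<tau>1 i n # ps2)"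
    proof -
      have "word ?\<tau> i j = word ?\<tau> i n @ word ?\<tau> n j" using n nj by (intro word_append) auto
      also have "word ?\<tau> i n = word \<tau>1 i n" by (rule word_cong) auto
      also have "word ?\<tau> n j = word \<tau>2 n j" by (rule word_cong) (use \<tau>1 \<tau>2 in auto)
      finally show ?thesis using \<tau>2(4) by simp
    qed
    ultimately show ?thesis using \<tau>1(1) \<tau>2(3) pc n
      by (intro exI[of _ ?\<tau>] exI[of _ "word \<tau>1 i n # ps2"]) auto
  qed
qed

lemma height_ends: "height 0 = 0" "height (length es) = 0"
proof -
  have "crank C {} = 0" using crank_le_card[of "{}" C] fcode_zero[OF C] by auto
  then show "height 0 = 0" "height (length es) = 0" using se unfolding cut_def lam_def by simp_all
qed

end

text \<open>With a single state at both ends, the emitted words of a behaviour are the code itself.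
  The conclusion compares words read along coordinate lists, a form that serves matroids and vector
  codes alike; coordinates of \<open>E j\<close> outside \<open>X\<close> and \<open>ks\<close> are
  deleted.\<close>

lemma code_minor_in_sequence:
  fixes C :: "nat \<Rightarrow> ('e \<Rightarrow> 'f::{field,finite}) set"
  assumes C: "\<And>i. fcode (C i)" and E: "\<And>i. finite (E i)" and ord: "\<And>i. \<exists>es. ordering_le (E i) (C i) K es"
  shows "\<exists>i j es ks X. i < j \<and> distinct es \<and> set es = E i \<and> distinct ks \<and> length ks = length es \<and>
    X \<subseteq> E j \<and> set ks \<subseteq> E j - X \<and> (\<lambda>c. map c es) ` C i = (\<lambda>c. map c ks) ` shortened (C j) X"
proof -
  have "\<exists>es. ordering_le (E i) (C i) K es \<and> linked_ordering (E i) (C i) es" for i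
    using linked_ordering_exists[OF C E] ord by blast
  then obtain es where es: "\<And>i. ordering_le (E i) (C i) K (es i)" "\<And>i. linked_ordering (E i) (C i) (es i)"
    by metis
  have tr: "trellis (E i) (C i) (es i)" for i
    using C E es(1) unfolding ordering_le_def by unfold_locales auto
  have "\<exists>\<tau> ps. trellis.labels (E i) (C i) (es i) \<tau> 0 (length (es i)) \<and> (\<forall>p\<in>set ps. piece K 0 p) \<and>
     map (trellis.sect (E i) (C i) (es i) \<tau>) [0..<length (es i)] = concat ps" for i
  proof -
    interpret trellis "E i" "C i" "es i" by (rule tr)
    obtain \<sigma> where "labelling (E i) (C i) (cut 0) \<sigma>" using labelling_exists[OF C E cut_subset] by blast
    moreover have "height l \<le> K" if "l \<le> length (es i)" for l
      using es(1)[of i] that unfolding ordering_le_def cut_def by blast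
    ultimately show ?thesis
      using word_decomposes[OF es(2), of K 0 "length (es i)" 0 \<sigma>] height_ends by blast
  qed
  then obtain \<tau> ps where \<tau>: "\<And>i. trellis.labels (E i) (C i) (es i) (\<tau> i) 0 (length (es i))"
    and ps: "\<And>i. \<forall>p\<in>set (ps i). piece K 0 p"
    and w: "\<And>i. map (trellis.sect (E i) (C i) (es i) (\<tau> i)) [0..<length (es i)] = concat (ps i)"
    by metis
  obtain i j where ij: "i < j" "emb 0 (concat (ps i)) (concat (ps j))"
    using wqo_concat_pieces[of ps K 0] ps by blast
  then obtain v' where v': "map snd v' = concat (ps j)"
    "rcomp (idk 0) (beh v') = rcomp (idk 0) (beh (keep (concat (ps i))))"
    unfolding emb_def by blast
  let ?n = "length (es j)" and ?m = "length (es i)"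
  let ?ctr = "\<lambda>i. trellis.sect (E i) (C i) (es i) (\<tau> i)"
  have lv: "length v' = ?n" using v'(1) w[of j] by (metis length_map length_upt minus_nat.diff_0)
  define \<alpha> where "\<alpha> l = fst (v' ! l)" for l
  have v: "v' = map (\<lambda>l. (\<alpha> l, ?ctr j l)) [0..<?n]"
  proof (rule nth_equalityI)
    fix l assume l: "l < length v'"
    have "snd (v' ! l) = ?ctr j l"
      using v'(1) w[of j] l lv by (metis (no_types, lifting) add_0 diff_zero length_upt nth_map nth_upt)
    then show "v' ! l = map (\<lambda>l. (\<alpha> l, ?ctr j l)) [0..<?n] ! l"
      using l lv by (simp add: \<alpha>_def prod_eq_iff)
  qed (simp add: lv)
  define ks where "ks = map ((!) (es j)) (filter (\<lambda>l. \<alpha> l = Keep) [0..<?n])"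
  define X where "X = {es j ! l |l. l < ?n \<and> \<alpha> l = Con}"
  have dj: "distinct (es j)" "set (es j) = E j" and di: "distinct (es i)" "set (es i) = E i"
    using es(1) unfolding ordering_le_def by auto
  have Xz: "(\<forall>l\<in>{0..<?n}. \<alpha> l = Con \<longrightarrow> c (es j ! l) = 0) \<longleftrightarrow> (\<forall>e\<in>X. c e = 0)" for c :: "'e \<Rightarrow> 'f"
    unfolding X_def by fastforce
  have bj: "(\<lambda>(s, u, t). u) ` rcomp (idk 0) (beh v') = (\<lambda>c. map c ks) ` shortened (C j) X"
  proof -
    interpret trellis "E j" "C j" "es j" by (rule tr)
    show ?thesis
      using beh_word[OF _ _ \<tau>[of j], of \<alpha>] unfolding v[symmetric] Xz height_ends
      by (auto simp: ks_def shortened_def image_iff comp_def)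
  qed
  have bi: "(\<lambda>(s, u, t). u) ` rcomp (idk 0) (beh (keep (concat (ps i)))) = (\<lambda>c. map c (es i)) ` C i"
  proof -
    interpret trellis "E i" "C i" "es i" by (rule tr)
    have "keep (concat (ps i)) = map (\<lambda>l. (Keep, ?ctr i l)) [0..<?m]" unfolding w[symmetric] by simp
    moreover have "map (\<lambda>l. c (es i ! l)) [0..<?m] = map c (es i)" for c :: "'e \<Rightarrow> 'f"
      by (rule nth_equalityI) auto
    ultimately show ?thesis
      using beh_word[OF _ _ \<tau>[of i], of "\<lambda>_. Keep"] unfolding height_ends
      by (auto simp: image_iff)
  qed
  have eq: "(\<lambda>c. map c (es i)) ` C i = (\<lambda>c. map c ks) ` shortened (C j) X"
    using bi bj v'(2) by simp
  \<comment> \<open>A code contains at least the zero word, so the common set of words determines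
    their length.\<close>
  have "map (\<lambda>_. 0) (es i) \<in> (\<lambda>c. map c ks) ` shortened (C j) X"
    unfolding eq[symmetric] using fcode_zero[OF C] by blast
  then have len: "length ks = ?m" by (metis (no_types, lifting) imageE length_map)
  have "distinct ks" unfolding ks_def using dj
    by (auto simp: distinct_map inj_on_def nth_eq_iff_index_eq)
  moreover have "X \<subseteq> E j" unfolding X_def dj(2)[symmetric] by auto
  moreover have "set ks \<subseteq> E j - X"
  proof
    fix x assume "x \<in> set ks"
    then obtain l where l: "l < ?n" "\<alpha> l = Keep" "x = es j ! l" unfolding ks_def by auto
    have "x \<notin> X"
    proof
      assume "x \<in> X"
      then obtain l' where l': "l' < ?n" "\<alpha> l' = Con" "x = es j ! l'" unfolding X_def by blast
      then have "l = l'" using l dj(1) nth_eq_iff_index_eq by metis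
      then show False using l l' by simp
    qed
    moreover have "x \<in> E j" using nth_mem[OF l(1)] unfolding l(3) dj(2) .
    ultimately show "x \<in> E j - X" by (rule DiffI[rotated])
  qed
  ultimately show ?thesis using ij(1) di len eq
    by (intro exI[of _ i] exI[of _ j] exI[of _ "es i"] exI[of _ ks] exI[of _ X] conjI)
qed

section \<open>Matroids of codes\<close>

text \<open>The code may have coordinates outside the image of the ground set, so that
  \<open>repr_delete\<close> leaves it unchanged. The map \<open>g\<close> lets minors keep the
  coordinates of the code they come from.\<close>

definition repr :: "'a matroid \<Rightarrow> ('a \<Rightarrow> 'e) \<Rightarrow> ('e \<Rightarrow> 'f) set \<Rightarrow> bool" where
  "repr M g C \<longleftrightarrow> finite (ground M) \<and> inj_on g (ground M) \<and>
     indeps M = {I. I \<subseteq> ground M \<and> free_on C (g ` I)}"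

lemma repr_rank:
  assumes M: "repr M g C" and Z: "Z \<subseteq> ground M"
  shows "matroid_rank M Z = crank C (g ` Z)"
proof -
  have inj: "inj_on g (ground M)" using M unfolding repr_def by blast
  have "card ` {I \<in> indeps M. I \<subseteq> Z} = card ` {J. J \<subseteq> g ` Z \<and> free_on C J}"
  proof (intro equalityI subsetI)
    fix n assume "n \<in> card ` {I \<in> indeps M. I \<subseteq> Z}"
    then obtain I where I: "I \<subseteq> Z" "free_on C (g ` I)" "n = card I"
      using M unfolding repr_def by auto
    have "card (g ` I) = card I" using I(1) Z inj by (meson card_image inj_on_subset order_trans)
    then show "n \<in> card ` {J. J \<subseteq> g ` Z \<and> free_on C J}" using I by (intro image_eqI[of _ _ "g ` I"]) auto
  next
    fix n assume "n \<in> card ` {J. J \<subseteq> g ` Z \<and> free_on C J}"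
    then obtain J where J: "J \<subseteq> g ` Z" "free_on C J" "n = card J" by auto
    then obtain I where I: "I \<subseteq> Z" "J = g ` I" by (meson subset_imageE)
    have "card (g ` I) = card I" using I(1) Z inj by (meson card_image inj_on_subset order_trans)
    then show "n \<in> card ` {I \<in> indeps M. I \<subseteq> Z}"
      using I J M Z unfolding repr_def by (intro image_eqI[of _ _ I]) auto
  qed
  then show ?thesis unfolding matroid_rank_def crank_def by simp
qed

lemma free_on_iff_crank:
  assumes "finite J" "C \<noteq> {}"
  shows "free_on C J \<longleftrightarrow> crank C J = card J"
proof
  assume "free_on C J"
  then show "crank C J = card J" using crank_ge[OF assms(1), of J C] crank_le_card[OF assms] by simp
next
  assume r: "crank C J = card J"
  obtain I where "I \<subseteq> J" "free_on C I" "card I = crank C J" using crank_witness[OF assms] by blast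
  then show "free_on C J" using r card_subset_eq[OF assms(1), of I] by simp
qed

lemma repr_contract:
  fixes C :: "('e \<Rightarrow> 'f::{field,finite}) set"
  assumes M: "repr M g C" and C: "fcode C" and X: "X \<subseteq> ground M"
  shows "repr (matroid_contract M X) g (shortened C (g ` X))"
proof -
  have fin: "finite (ground M)" and inj: "inj_on g (ground M)" using M unfolding repr_def by auto
  have "matroid_rank M (I \<union> X) = card I + matroid_rank M X \<longleftrightarrow> free_on (shortened C (g ` X)) (g ` I)"
    if I: "I \<subseteq> ground M - X" for I
  proof -
    have f: "finite (g ` I)" "finite (g ` X)" 
      using I finite_subset[OF X fin] finite_subset[of I "ground M"] fin by auto
    have "I \<union> X \<subseteq> ground M" using I X by auto
    then have "matroid_rank M (I \<union> X) = crank C (g ` X \<union> g ` I)"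
      using repr_rank[OF M] by (metis image_Un sup_commute)
    also have "\<dots> = crank (shortened C (g ` X)) (g ` I) + matroid_rank M X"
      using crank_shortened[OF C f(2,1)] repr_rank[OF M X] by simp
    finally have "matroid_rank M (I \<union> X) = card I + matroid_rank M X \<longleftrightarrow>
        crank (shortened C (g ` X)) (g ` I) = card I" by simp
    moreover have "card (g ` I) = card I"
      using I inj by (metis Diff_subset card_image inj_on_subset order_trans)
    ultimately have *: "matroid_rank M (I \<union> X) = card I + matroid_rank M X \<longleftrightarrow>
        crank (shortened C (g ` X)) (g ` I) = card (g ` I)" by simp
    have "shortened C (g ` X) \<noteq> {}" using fcode_zero[OF shortened_fcode[OF C, of "g ` X"]] by blast
    then show ?thesis unfolding * by (rule free_on_iff_crank[OF f(1), symmetric])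
  qed
  then show ?thesis using fin inj unfolding repr_def matroid_contract_def
    by (auto simp: inj_on_diff)
qed

lemma repr_delete:
  assumes M: "repr M g C"
  shows "repr (matroid_delete M Y) g C"
  using M unfolding repr_def matroid_delete_def by (auto simp: inj_on_diff)

lemma ground_minor [simp]:
  "ground (matroid_delete M Y) = ground M - Y" "ground (matroid_contract M X) = ground M - X"
  unfolding matroid_delete_def matroid_contract_def by auto

lemma repr_connectivity:
  fixes C :: "('e \<Rightarrow> 'f::{field,finite}) set"
  assumes M: "repr M g C" and C: "fcode C" and A: "A \<subseteq> ground M"
  shows "connectivity M A = int (lam (g ` ground M) C (g ` A))"
proof -
  have inj: "inj_on g (ground M)" and fin: "finite (ground M)" using M unfolding repr_def by auto
  have sub: "g ` A \<subseteq> g ` ground M" and fg: "finite (g ` ground M)" using A fin by auto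
  have "g ` (ground M - A) = g ` ground M - g ` A" using inj_on_image_set_diff[OF inj _ A] by simp
  then have "matroid_rank M (ground M - A) = crank C (g ` ground M - g ` A)"
    using repr_rank[OF M, of "ground M - A"] by simp
  then show ?thesis
    using repr_rank[OF M A] repr_rank[OF M subset_refl] lam_add[OF C fg sub]
    unfolding connectivity_def by simp
qed

lemma ordering_width_le_iff:
  fixes C :: "('e \<Rightarrow> 'f::{field,finite}) set"
  assumes M: "repr M g C" and C: "fcode C" and es: "distinct es" "set es = ground M"
  shows "ordering_width M es \<le> int w \<longleftrightarrow> ordering_le (g ` ground M) C w (map g es)"
proof -
  have inj: "inj_on g (ground M)" using M unfolding repr_def by auto
  have "connectivity M (set (take l es)) = int (lam (g ` ground M) C (set (take l (map g es))))" for l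
  proof -
    have "set (take l es) \<subseteq> ground M" using es(2) set_take_subset[of l es] by simp
    then show ?thesis using repr_connectivity[OF M C] by (simp add: take_map)
  qed
  then have "ordering_width M es \<le> int w \<longleftrightarrow>
      (\<forall>l\<le>length es. lam (g ` ground M) C (set (take l (map g es))) \<le> w)"
    unfolding ordering_width_def by (subst Max_le_iff) auto
  then show ?thesis using es inj unfolding ordering_le_def by (simp add: distinct_map)
qed

lemma repr_pathwidth_le_iff:
  fixes C :: "('e \<Rightarrow> 'f::{field,finite}) set"
  assumes M: "repr M g C" and C: "fcode C"
  shows "pathwidth M \<le> int w \<longleftrightarrow> (\<exists>es. ordering_le (g ` ground M) C w es)"
proof -
  have fin: "finite (ground M)" and inj: "inj_on g (ground M)" using M unfolding repr_def by auto
  let ?S = "{es. distinct es \<and> set es = ground M}"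
  have "?S \<subseteq> {es. set es \<subseteq> ground M \<and> length es \<le> card (ground M)}"
    by (auto simp: distinct_card[symmetric])
  then have finS: "finite ?S" using finite_lists_length_le[OF fin] finite_subset by blast
  have "?S \<noteq> {}" using finite_distinct_list[OF fin] by auto
  then have "pathwidth M \<le> int w \<longleftrightarrow> (\<exists>es\<in>?S. ordering_width M es \<le> int w)"
    unfolding pathwidth_def using finS by (subst Min_le_iff) auto
  also have "\<dots> \<longleftrightarrow> (\<exists>es\<in>?S. ordering_le (g ` ground M) C w (map g es))"
    using ordering_width_le_iff[OF M C] by auto
  also have "\<dots> \<longleftrightarrow> (\<exists>es. ordering_le (g ` ground M) C w es)"
  proof
    assume "\<exists>es. ordering_le (g ` ground M) C w es"
    then obtain fs where fs: "ordering_le (g ` ground M) C w fs" by blast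
    define es where "es = map (inv_into (ground M) g) fs"
    have sf: "set fs = g ` ground M" "distinct fs" using fs unfolding ordering_le_def by auto
    have "map g es = fs" unfolding es_def map_map
      by (rule map_idI) (simp add: sf f_inv_into_f)
    moreover have "set es = ground M" unfolding es_def using sf inj
      by (simp add: inv_into_image_cancel)
    moreover have "distinct es" using calculation(1) sf(2) distinct_map by metis
    ultimately show "\<exists>es\<in>?S. ordering_le (g ` ground M) C w (map g es)" using fs by auto
  qed auto
  finally show ?thesis .
qed

lemma repr_iso:
  assumes N: "repr N g C" and M: "indeps M \<subseteq> Pow (ground M)"
    and f: "bij_betw f (ground M) (ground N)" "indeps N = (\<lambda>I. f ` I) ` indeps M"
  shows "repr M (g \<circ> f) C" "(g \<circ> f) ` ground M = g ` ground N"
proof -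
  have inj: "inj_on f (ground M)" and im: "f ` ground M = ground N" using f(1) unfolding bij_betw_def by auto
  show "(g \<circ> f) ` ground M = g ` ground N" by (simp only: im[symmetric] image_comp)
  have ind: "I \<in> indeps M \<longleftrightarrow> I \<subseteq> ground M \<and> free_on C (g ` f ` I)" for I
  proof
    assume I: "I \<in> indeps M"
    then have "f ` I \<in> indeps N" using f(2) by blast
    then show "I \<subseteq> ground M \<and> free_on C (g ` f ` I)" using I M N unfolding repr_def by blast
  next
    assume I: "I \<subseteq> ground M \<and> free_on C (g ` f ` I)"
    then have "f ` I \<in> indeps N" using N im unfolding repr_def by auto
    then obtain I' where I': "I' \<in> indeps M" "f ` I = f ` I'" using f(2) by auto
    then have "I = I'" using inj_on_image_eq_iff[OF inj, of I I'] I M by blast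
    then show "I \<in> indeps M" using I' by simp
  qed
  have "finite (ground M)" using N f(1) bij_betw_finite unfolding repr_def by blast
  moreover have "inj_on (g \<circ> f) (ground M)" using N inj im unfolding repr_def by (intro comp_inj_on) auto
  ultimately show "repr M (g \<circ> f) C" unfolding repr_def using ind by (auto simp: image_comp)
qed

text \<open>Freeness depends only on the words read along \<open>es\<close>. Codes with equal words
  along two lists therefore have the same free positions, which is what \<open>repr_transfer\<close>
  uses.\<close>

lemma free_on_map:
  assumes "distinct es" "L \<subseteq> {..<length es}"
  shows "free_on C ((!) es ` L) \<longleftrightarrow> (\<forall>h. \<exists>u\<in>(\<lambda>c. map c es) ` C. \<forall>l\<in>L. u ! l = h l)"
proof
  assume fr: "free_on C ((!) es ` L)"
  show "\<forall>h. \<exists>u\<in>(\<lambda>c. map c es) ` C. \<forall>l\<in>L. u ! l = h l"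
  proof
    fix h :: "nat \<Rightarrow> 'b"
    have inj: "inj_on ((!) es) L" by (rule inj_on_nth[OF assms(1)]) (use assms(2) in auto)
    obtain c where c: "c \<in> C" "\<forall>e\<in>(!) es ` L. c e = h (inv_into L ((!) es) e)"
      using fr unfolding free_on_def by (elim allE[of _ "\<lambda>e. h (inv_into L ((!) es) e)"]) blast
    have "map c es ! l = h l" if "l \<in> L" for l
      using c(2) that assms(2) inv_into_f_f[OF inj that] by (metis imageI lessThan_iff nth_map subsetD)
    then show "\<exists>u\<in>(\<lambda>c. map c es) ` C. \<forall>l\<in>L. u ! l = h l" using c(1) by blast
  qed
next
  assume *: "\<forall>h. \<exists>u\<in>(\<lambda>c. map c es) ` C. \<forall>l\<in>L. u ! l = h l"
  show "free_on C ((!) es ` L)" unfolding free_on_def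
  proof
    fix g
    obtain c where c: "c \<in> C" "\<forall>l\<in>L. map c es ! l = g (es ! l)"
      using *[rule_format, of "\<lambda>l. g (es ! l)"] by blast
    have "c (es ! l) = g (es ! l)" if "l \<in> L" for l
    proof -
      have "l < length es" using that assms(2) by blast
      then show ?thesis using bspec[OF c(2) that] by simp
    qed
    then show "\<exists>c\<in>C. \<forall>e\<in>(!) es ` L. c e = g e" using c(1) by blast
  qed
qed

lemma repr_transfer:
  assumes M: "repr M g C" and es: "distinct es" "set es = g ` ground M"
    and ks: "distinct ks" "length ks = length es"
    and eq: "(\<lambda>c. map c es) ` C = (\<lambda>c. map c ks) ` D"
  shows "\<exists>h. repr M h D \<and> h ` ground M = set ks"
proof -
  have fin: "finite (ground M)" and inj: "inj_on g (ground M)"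
    and ind: "indeps M = {I. I \<subseteq> ground M \<and> free_on C (g ` I)}" using M unfolding repr_def by auto
  \<comment> \<open>The position of an element in \<open>es\<close>; the same position in
    \<open>ks\<close> gives its new coordinate.\<close>
  define p where "p = inv_into {..<length es} ((!) es) \<circ> g"
  have bij: "bij_betw ((!) es) {..<length es} (g ` ground M)"
    using bij_betw_nth[OF es(1) refl es(2)[symmetric]] .
  have "bij_betw g (ground M) (g ` ground M)" using inj unfolding bij_betw_def by simp
  then have p: "bij_betw p (ground M) {..<length es}"
    unfolding p_def using bij_betw_inv_into[OF bij] by (rule bij_betw_trans)
  have ep: "es ! p x = g x" if "x \<in> ground M" for x
    unfolding p_def comp_def using bij that by (metis bij_betw_imp_surj_on f_inv_into_f imageI)
  let ?h = "(!) ks \<circ> p"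
  have "free_on C (g ` I) \<longleftrightarrow> free_on D (?h ` I)" if I: "I \<subseteq> ground M" for I
  proof -
    have L: "p ` I \<subseteq> {..<length es}" using p I unfolding bij_betw_def by blast
    have "g ` I = (!) es ` p ` I" using ep I by (force simp: image_comp intro!: image_cong)
    then have "free_on C (g ` I) \<longleftrightarrow> (\<forall>h. \<exists>u\<in>(\<lambda>c. map c es) ` C. \<forall>l\<in>p ` I. u ! l = h l)"
      using free_on_map[OF es(1) L] by simp
    also have "\<dots> \<longleftrightarrow> free_on D ((!) ks ` p ` I)" unfolding eq
      by (rule free_on_map[OF ks(1), symmetric]) (use L ks in simp)
    finally show ?thesis by (simp add: image_comp)
  qed
  then have "indeps M = {I. I \<subseteq> ground M \<and> free_on D (?h ` I)}" unfolding ind by blast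
  moreover have bk: "bij_betw ?h (ground M) (set ks)"
    by (rule bij_betw_trans[OF p]) (use bij_betw_nth[OF ks(1) refl refl] ks(2) in simp)
  ultimately have "repr M ?h D" using fin unfolding repr_def bij_betw_def by blast
  then show ?thesis using bk unfolding bij_betw_def by blast
qed

text \<open>This is the source of the bound \<open>w + 1\<close> on excluded minors: putting
  \<open>x\<close> back raises the rank of the right side of a cut by at most 1 and cannot lower the
  total rank, while the final cut has connectivity 0.\<close>

lemma ordering_le_insert:
  fixes C :: "('e \<Rightarrow> 'f::{field,finite}) set"
  assumes C: "fcode C" and E: "finite E" and x: "x \<in> E" and es: "ordering_le (E - {x}) C w es"
  shows "ordering_le E C (Suc w) (es @ [x])"
proof -
  have ne: "C \<noteq> {}" using fcode_zero[OF C] by blast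
  have se: "distinct es" "set es = E - {x}"
    and le: "lam (E - {x}) C (set (take l es)) \<le> w" if "l \<le> length es" for l
    using es that unfolding ordering_le_def by auto
  have step: "lam E C A \<le> Suc (lam (E - {x}) C A)" if A: "A \<subseteq> E - {x}" for A
  proof -
    have f: "finite (E - {x})" "finite (E - {x} - A)" and AE: "A \<subseteq> E" using E A by auto
    have "E - A = {x} \<union> (E - {x} - A)" using A x by auto
    then have "crank C (E - A) \<le> Suc (crank C (E - {x} - A))"
      using crank_subadd[OF C _ f(2), of "{x}"] crank_le_card[of "{x}" C] ne by simp
    moreover have "crank C (E - {x}) \<le> crank C E" using E ne by (intro crank_mono) auto
    ultimately show ?thesis using lam_add[OF C E AE] lam_add[OF C f(1) A] by linarith
  qed
  have full: "lam E C E = 0"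
    using lam_add[OF C E subset_refl] crank_le_card[of "{}" C] ne by simp
  show ?thesis unfolding ordering_le_def
  proof (intro conjI allI impI)
    show "distinct (es @ [x])" "set (es @ [x]) = E" using es x unfolding ordering_le_def by auto
    fix l assume l: "l \<le> length (es @ [x])"
    show "lam E C (set (take l (es @ [x]))) \<le> Suc w"
    proof (cases "l \<le> length es")
      case True
      have "set (take l es) \<subseteq> E - {x}"
        using set_take_subset[of l es] es unfolding ordering_le_def by auto
      then show ?thesis using step[of "set (take l es)"] le[OF True] True by simp
    next
      case False
      then have "l = Suc (length es)" using l by simp
      moreover have "insert x (set es) = E" using es x unfolding ordering_le_def by auto
      ultimately show ?thesis using full by simp
    qed
  qed
qed

section \<open>Vector matroids\<close>

definition row_code :: "'f::field mat \<Rightarrow> (nat \<Rightarrow> 'f) set" where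
  "row_code A = (\<lambda>v i. if i < dim_col A then v \<bullet> col A i else 0) ` carrier_vec (dim_row A)"

lemma finite_carrier_vec: "finite (carrier_vec n :: 'f::finite vec set)"
proof -
  have "carrier_vec n \<subseteq> vec_of_list ` {xs :: 'f list. set xs \<subseteq> UNIV \<and> length xs = n}"
  proof
    fix v :: "'f vec" assume "v \<in> carrier_vec n"
    then show "v \<in> vec_of_list ` {xs. set xs \<subseteq> UNIV \<and> length xs = n}"
      by (intro image_eqI[of _ _ "list_of_vec v"]) (auto simp: vec_list)
  qed
  then show ?thesis by (rule finite_subset) (rule finite_imageI[OF finite_lists_length_eq[OF finite]])
qed

lemma row_code_fcode: "fcode (row_code (A :: 'f::{field,finite} mat))"
  unfolding fcode_def
proof (intro conjI ballI allI)
  let ?f = "\<lambda>v i. if i < dim_col A then v \<bullet> col A i else 0"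
  show "finite (row_code A)" unfolding row_code_def using finite_carrier_vec by blast
  have "?f (0\<^sub>v (dim_row A)) = (\<lambda>_. 0)" by auto
  then show "(\<lambda>_. 0) \<in> row_code A" unfolding row_code_def
    by (rule image_eqI[OF sym]) (rule zero_carrier_vec)
next
  let ?f = "\<lambda>v i. if i < dim_col A then v \<bullet> col A i else 0"
  fix c d assume "c \<in> row_code A" "d \<in> row_code A"
  then obtain u v where uv: "u \<in> carrier_vec (dim_row A)" "v \<in> carrier_vec (dim_row A)"
    "c = ?f u" "d = ?f v" unfolding row_code_def by blast
  have "(\<lambda>e. c e + d e) = ?f (u + v)" using uv by (auto simp: add_scalar_prod_distrib[OF uv(1,2)])
  then show "(\<lambda>e. c e + d e) \<in> row_code A" unfolding row_code_def using uv by auto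
next
  let ?f = "\<lambda>v i. if i < dim_col A then v \<bullet> col A i else 0"
  fix a c assume "c \<in> row_code A"
  then obtain u where u: "u \<in> carrier_vec (dim_row A)" "c = ?f u" unfolding row_code_def by blast
  have "(\<lambda>e. a * c e) = ?f (a \<cdot>\<^sub>v u)" using u by (auto simp: fun_eq_iff)
  then show "(\<lambda>e. a * c e) \<in> row_code A" unfolding row_code_def using u by auto
qed

lemma fcode_sum:
  assumes "fcode C" "finite S" "\<And>j. j \<in> S \<Longrightarrow> c j \<in> C"
  shows "(\<lambda>e. \<Sum>j\<in>S. a j * c j e) \<in> C"
  using assms(2,3)
proof (induction S rule: finite_induct)
  case empty
  then show ?case using fcode_zero[OF assms(1)] by simp
next
  case (insert x S)
  then show ?case using fcode_add[OF assms(1) fcode_scale[OF assms(1), of "c x" "a x"]] by simp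
qed

text \<open>Freeness yields vectors dual to the columns in \<open>J\<close>, which exclude
  repetitions and dependences. Conversely, if \<open>J\<close> is not free, a largest free
  \<open>I\<close> determines a further coordinate \<open>e\<close> linearly, and reading this
  relation in every row gives a dependence of columns.\<close>

lemma col_independent_iff:
  fixes A :: "'f::{field,finite} mat"
  assumes J: "J \<subseteq> {..<dim_col A}"
  shows "inj_on (col A) J \<and> \<not> module.lin_dep class_ring (module_vec TYPE('f) (dim_row A)) (col A ` J)
     \<longleftrightarrow> free_on (row_code A) J"
proof -
  let ?n = "dim_row A" and ?C = "row_code A"
  interpret vec_space "TYPE('f)" ?n .
  have finJ: "finite J" using J finite_subset by blast
  have colc: "col A j \<in> carrier_vec ?n" for j by simp
  show ?thesis
  proof
    assume fr: "free_on ?C J"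
    have pick: "\<exists>v\<in>carrier_vec ?n. \<forall>i\<in>J. v \<bullet> col A i = (if i = j then 1 else 0)" for j
    proof -
      obtain c where c: "c \<in> ?C" "\<forall>i\<in>J. c i = (if i = j then 1 else 0)"
        using fr unfolding free_on_def by (elim allE[of _ "\<lambda>i. if i = j then 1 else 0"]) blast
      then obtain v where v: "v \<in> carrier_vec ?n" "c = (\<lambda>i. if i < dim_col A then v \<bullet> col A i else 0)"
        unfolding row_code_def by blast
      have "v \<bullet> col A i = (if i = j then 1 else 0)" if "i \<in> J" for i
      proof -
        have "i < dim_col A" using J that by blast
        then show ?thesis using bspec[OF c(2) that] unfolding v(2) by simp
      qed
      then show ?thesis using v(1) by blast
    qed
    have inj: "inj_on (col A) J"
    proof (rule inj_onI, rule ccontr)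
      fix i j assume ij: "i \<in> J" "j \<in> J" "col A i = col A j" "i \<noteq> j"
      then show False using pick[of j] by (metis zero_neq_one)
    qed
    moreover have "\<not> lin_dep (col A ` J)"
    proof
      assume "lin_dep (col A ` J)"
      then obtain S a u where S: "finite S" "S \<subseteq> col A ` J" "lincomb a S = 0\<^sub>v ?n" "u \<in> S" "a u \<noteq> 0"
        unfolding lin_dep_def by auto
      obtain j where j: "j \<in> J" "u = col A j" using S by blast
      obtain v where v: "v \<in> carrier_vec ?n" "\<forall>i\<in>J. v \<bullet> col A i = (if i = j then 1 else 0)"
        using pick by blast
      have Sc: "S \<subseteq> carrier_vec ?n" using S(2) by auto
      have vx: "v \<bullet> x = (if x = u then 1 else 0)" if "x \<in> S" for x
        using that S(2) v(2) j inj by (auto simp: inj_on_eq_iff)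
      have "0 = v \<bullet> lincomb a S" using S(3) v(1) by simp
      also have "\<dots> = (\<Sum>i<?n. v $ i * (\<Sum>x\<in>S. a x * x $ i))"
        unfolding scalar_prod_def using lincomb_dim[OF S(1) Sc, of a]
        by (simp add: lincomb_index[OF _ Sc] atLeast0LessThan)
      also have "\<dots> = (\<Sum>x\<in>S. a x * (\<Sum>i<?n. v $ i * x $ i))"
        by (simp add: sum_distrib_left sum.swap[of _ S] mult.left_commute)
      also have "\<dots> = (\<Sum>x\<in>S. a x * (v \<bullet> x))"
        using Sc by (intro sum.cong) (auto simp: scalar_prod_def atLeast0LessThan)
      also have "\<dots> = (\<Sum>x\<in>S. if x = u then a x else 0)" using vx by (intro sum.cong) auto
      also have "\<dots> = a u" using S by simp
      finally show False using S(5) by simp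
    qed
    ultimately show "inj_on (col A) J \<and> \<not> lin_dep (col A ` J)" by blast
  next
    assume ind: "inj_on (col A) J \<and> \<not> lin_dep (col A ` J)"
    show "free_on ?C J"
    proof (rule ccontr)
      assume nf: "\<not> free_on ?C J"
      have C: "fcode ?C" by (rule row_code_fcode)
      obtain I where I: "I \<subseteq> J" "free_on ?C I" "card I = crank ?C J"
        using crank_witness[OF finJ] fcode_zero[OF C] by blast
      have finI: "finite I" using I finJ finite_subset by blast
      have "I \<noteq> J" using I nf by blast
      then obtain e where e: "e \<in> J" "e \<notin> I" using I by blast
      have det: "c e = 0" if c: "c \<in> ?C" "\<forall>i\<in>I. c i = 0" for c
      proof (rule ccontr)
        assume "c e \<noteq> 0"
        then have "free_on ?C (insert e I)" using free_on_insert[OF C I(2) c] by blast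
        then have "card (insert e I) \<le> card I"
          unfolding I(3) by (rule crank_ge[OF finJ, rotated]) (use e I in auto)
        then show False using e finI by simp
      qed
      \<comment> \<open>Codewords dual to the coordinates in \<open>I\<close>: the value of any
        codeword at \<open>e\<close> will be the combination of its values on \<open>I\<close> with
        coefficients \<open>b j e\<close>.\<close>
      have "\<exists>c\<in>?C. \<forall>i\<in>I. c i = (if i = j then 1 else 0)" for j
        using I(2) unfolding free_on_def by (elim allE[of _ "\<lambda>i. if i = j then 1 else 0"])
      then obtain b where b: "\<And>j. b j \<in> ?C" "\<And>i j. i \<in> I \<Longrightarrow> b j i = (if i = j then 1 else 0)" by metis
      have dep: "c e = (\<Sum>j\<in>I. c j * b j e)" if c: "c \<in> ?C" for c
      proof -
        have "(\<lambda>i. c i - (\<Sum>j\<in>I. c j * b j i)) \<in> ?C"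
          using fcode_diff[OF C c fcode_sum[OF C finI b(1)]] .
        moreover have "\<forall>i\<in>I. c i - (\<Sum>j\<in>I. c j * b j i) = 0"
        proof
          fix i assume i: "i \<in> I"
          have "(\<Sum>j\<in>I. c j * b j i) = (\<Sum>j\<in>I. if i = j then c j else 0)"
            by (rule sum.cong) (simp_all add: b(2)[OF i])
          also have "\<dots> = c i" using finI i by simp
          finally show "c i - (\<Sum>j\<in>I. c j * b j i) = 0" by simp
        qed
        ultimately have "c e - (\<Sum>j\<in>I. c j * b j e) = 0" by (rule det)
        then show ?thesis by simp
      qed
      let ?T = "insert e I"
      have TJ: "?T \<subseteq> J" using e I by auto
      have injT: "inj_on (col A) ?T" using ind TJ inj_on_subset by blast
      \<comment> \<open>\<open>lincomb\<close> takes coefficients on vectors, so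
        \<open>inv_into\<close> recovers the index, unique by \<open>injT\<close>. The coefficient
        -1 of \<open>col A e\<close> makes the dependence nontrivial.\<close>
      define a where "a x = (let j = inv_into ?T (col A) x in if j = e then - 1 else b j e)" for x
      have a: "a (col A j) = (if j = e then - 1 else b j e)" if "j \<in> ?T" for j
        unfolding a_def Let_def using inv_into_f_f[OF injT that] by simp
      have Tc: "col A ` ?T \<subseteq> carrier_vec ?n" by auto
      have "lincomb a (col A ` ?T) = 0\<^sub>v ?n"
      proof (rule eq_vecI)
        show "dim_vec (lincomb a (col A ` ?T)) = dim_vec (0\<^sub>v ?n)"
          using lincomb_dim[OF _ Tc] finI by simp
        fix i assume "i < dim_vec (0\<^sub>v ?n)"
        then have i: "i < ?n" by simp
        \<comment> \<open>Row \<open>i\<close> of \<open>A\<close> as a codeword, so that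
          \<open>dep\<close> applies to the entries at index \<open>i\<close> of the
          columns.\<close>
        let ?c = "\<lambda>j. if j < dim_col A then unit_vec ?n i \<bullet> col A j else 0"
        have cC: "?c \<in> ?C" unfolding row_code_def by (rule image_eqI[OF refl]) simp
        have c: "?c j = col A j $ i" if "j \<in> J" for j
        proof -
          have "j < dim_col A" using that J by blast
          then show ?thesis using scalar_prod_left_unit[OF colc i, of j] by simp
        qed
        have "(\<Sum>j\<in>I. ?c j * b j e) = (\<Sum>j\<in>I. col A j $ i * b j e)"
        proof (rule sum.cong[OF refl])
          fix j assume "j \<in> I"
          then have "j \<in> J" using I(1) by blast
          then show "?c j * b j e = col A j $ i * b j e" by (simp only: c)
        qed
        then have d: "col A e $ i = (\<Sum>j\<in>I. col A j $ i * b j e)"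
          using dep[OF cC] c[OF e(1)] by simp
        have "lincomb a (col A ` ?T) $ i = (\<Sum>x\<in>col A ` ?T. a x * x $ i)" by (rule lincomb_index[OF i Tc])
        also have "\<dots> = (\<Sum>j\<in>?T. a (col A j) * col A j $ i)" 
          by (simp only: sum.reindex[OF injT] comp_def)
        also have "\<dots> = (\<Sum>j\<in>?T. (if j = e then - 1 else b j e) * col A j $ i)"
          using a by (intro sum.cong) auto
        also have "\<dots> = - (col A e $ i) + (\<Sum>j\<in>I. (if j = e then - 1 else b j e) * col A j $ i)"
          using finI e by simp
        also have "(\<Sum>j\<in>I. (if j = e then - 1 else b j e) * col A j $ i) = (\<Sum>j\<in>I. col A j $ i * b j e)"
          using e by (intro sum.cong) auto
        finally show "lincomb a (col A ` ?T) $ i = 0\<^sub>v ?n $ i" using d i by simp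
      qed
      moreover have "a (col A e) \<noteq> 0" using a[of e] by simp
      ultimately have "lin_dep (col A ` J)"
        unfolding lin_dep_def using finI TJ
        by (intro exI[of _ "col A ` ?T"] exI[of _ a] exI[of _ "col A e"]) auto
      then show False using ind by blast
    qed
  qed
qed

lemma repr_vector_matroid: "repr (vector_matroid (A :: 'f::{field,finite} mat)) id (row_code A)"
  unfolding repr_def vector_matroid_def using col_independent_iff[of _ A] by auto

section \<open>Linear codes\<close>

lemma linear_code_of_length_iff:
  "linear_code_of_length n (C :: 'f::field vec set) \<longleftrightarrow> C \<subseteq> carrier_vec n \<and> 0\<^sub>v n \<in> C \<and>
     (\<forall>u\<in>C. \<forall>v\<in>C. u + v \<in> C) \<and> (\<forall>a. \<forall>v\<in>C. a \<cdot>\<^sub>v v \<in> C)"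
  using vec_vs[where 'a='f, of n] vec_module[where 'a='f, of n]
  unfolding linear_code_of_length_def VectorSpace.subspace_def submodule_def
  by (auto simp: module_vec_simps)

text \<open>A largest independent subset of the finite code spans it, as otherwise a codeword could
  be added. This justifies the \<open>SOME\<close> in \<open>code_matroid\<close>.\<close>

lemma generator_matrix_exists:
  assumes C: "linear_code_of_length n (C :: 'f::{field,finite} vec set)"
  shows "\<exists>G. is_generator_matrix G C"
proof -
  interpret vec_space "TYPE('f)" n .
  have sub: "submodule class_ring C V" using C unfolding linear_code_of_length_def VectorSpace.subspace_def by blast
  have CV: "C \<subseteq> carrier_vec n" using C unfolding linear_code_of_length_iff by blast
  have finC: "finite C" using finite_subset[OF CV finite_carrier_vec] .
  let ?P = "\<lambda>B. B \<subseteq> C \<and> \<not> lin_dep B"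
  have "\<not> lin_dep {}" unfolding lin_dep_def by auto
  then have "?P {}" by blast
  moreover have "\<forall>B. ?P B \<longrightarrow> card B < Suc (card C)" using card_mono[OF finC] by (simp add: less_Suc_eq_le)
  ultimately have "\<exists>B. ?P B \<and> (\<forall>B'. ?P B' \<longrightarrow> card B' \<le> card B)" by (rule ex_has_greatest_nat)
  then obtain B where B: "B \<subseteq> C" "\<not> lin_dep B" and max: "\<And>B'. B' \<subseteq> C \<Longrightarrow> \<not> lin_dep B' \<Longrightarrow> card B' \<le> card B"
    by blast
  have finB: "finite B" using finite_subset[OF B(1) finC] .
  have BV: "B \<subseteq> carrier_vec n" using B(1) CV by auto
  have "span B = C"
  proof
    show "span B \<subseteq> C" using span_is_subset[OF B(1) sub] .
    show "C \<subseteq> span B"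
    proof
      fix v assume v: "v \<in> C"
      show "v \<in> span B"
      proof (cases "v \<in> B")
        case True
        then show ?thesis using in_own_span[of B] B(1) CV by blast
      next
        case False
        show ?thesis
        proof (rule ccontr)
          assume "v \<notin> span B"
          then have "\<not> lin_dep (B \<union> {v})" using lin_dep_iff_in_span[OF BV B(2) _ False] v CV by auto
          then have "card (B \<union> {v}) \<le> card B" using max[of "B \<union> {v}"] B(1) v by simp
          then show False using False finB by simp
        qed
      qed
    qed
  qed
  moreover obtain bs where bs: "set bs = B" "distinct bs" using finite_distinct_list[OF finB] by blast
  moreover have "rows (mat_of_rows n bs) = bs" using rows_mat_of_rows[of bs n] bs BV by auto
  ultimately have "is_generator_matrix (mat_of_rows n bs) C"
    using B(2) by (simp add: is_generator_matrix_def row_space_def)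
  then show ?thesis by blast
qed

section \<open>Vector codes, their matroids and their minors\<close>

definition vec_code :: "nat \<Rightarrow> 'f::field vec set \<Rightarrow> (nat \<Rightarrow> 'f) set" where
  "vec_code n C = (\<lambda>v i. if i < n then v $ i else 0) ` C"

lemma row_code_generator_matrix:
  assumes C: "linear_code_of_length n (C :: 'f::{field,finite} vec set)" and G: "is_generator_matrix G C"
  shows "dim_col G = n" "row_code G = vec_code n C"
proof -
  interpret vec_space "TYPE('f)" "dim_col G" .
  have Ceq: "C = {w \<in> carrier_vec (dim_col G). \<exists>y\<in>carrier_vec (dim_row G). G\<^sup>T *\<^sub>v y = w}"
    using G row_space_eq[of G "dim_row G"] unfolding is_generator_matrix_def by auto
  have "0\<^sub>v n \<in> C" using C unfolding linear_code_of_length_iff by blast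
  then show n: "dim_col G = n" unfolding Ceq by (metis (no_types, lifting) carrier_vecD index_zero_vec(2) mem_Collect_eq)
  have C2: "C = (\<lambda>y. G\<^sup>T *\<^sub>v y) ` carrier_vec (dim_row G)"
    unfolding Ceq by (auto intro!: carrier_vecI)
  have "(if i < n then (G\<^sup>T *\<^sub>v y) $ i else 0) = (if i < dim_col G then y \<bullet> col G i else 0)"
    if "y \<in> carrier_vec (dim_row G)" for y i
    using n that comm_scalar_prod[OF col_dim that, of i] by simp
  then show "row_code G = vec_code n C" unfolding row_code_def vec_code_def C2 image_image
    by (intro image_cong refl ext) (simp add: n)
qed

lemma code_matroid_repr:
  assumes C: "linear_code_of_length n (C :: 'f::{field,finite} vec set)"
  shows "repr (code_matroid C) id (vec_code n C)" "ground (code_matroid C) = {..<n}" "fcode (vec_code n C)"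
proof -
  let ?G = "SOME G. is_generator_matrix G C"
  have G: "is_generator_matrix ?G C" using generator_matrix_exists[OF C] by (rule someI_ex)
  note r = row_code_generator_matrix[OF C G]
  show "repr (code_matroid C) id (vec_code n C)"
    unfolding code_matroid_def r(2)[symmetric] by (rule repr_vector_matroid)
  show "ground (code_matroid C) = {..<n}" unfolding code_matroid_def vector_matroid_def by (simp add: r(1))
  show "fcode (vec_code n C)" unfolding r(2)[symmetric] by (rule row_code_fcode)
qed

lemma trellis_width_le_iff:
  assumes C: "linear_code_of_length n (C :: 'f::{field,finite} vec set)"
  shows "trellis_width C \<le> int w \<longleftrightarrow> (\<exists>es. ordering_le {..<n} (vec_code n C) w es)"
  using repr_pathwidth_le_iff[OF code_matroid_repr(1,3)[OF C], of w] code_matroid_repr(2)[OF C]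
  unfolding trellis_width_def by simp

text \<open>A single puncturing or shortening renumbers the later coordinates. Giving the original
  indices of the remaining coordinates in \<open>ks\<close> and of the shortened ones in
  \<open>X\<close> avoids following the renumbering.\<close>

definition coord_minor :: "'f::field vec set \<Rightarrow> nat list \<Rightarrow> nat set \<Rightarrow> 'f vec set" where
  "coord_minor C ks X = (\<lambda>c. vec (length ks) (\<lambda>l. c $ (ks ! l))) ` {c \<in> C. \<forall>x\<in>X. c $ x = 0}"

lemma coord_minor_linear:
  assumes C: "linear_code_of_length n C" and ks: "set ks \<subseteq> {..<n}" and X: "X \<subseteq> {..<n}"
  shows "linear_code_of_length (length ks) (coord_minor C ks X)"
proof -
  let ?f = "\<lambda>c. vec (length ks) (\<lambda>l. c $ (ks ! l))" and ?S = "{c \<in> C. \<forall>x\<in>X. c $ x = 0}"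
  have CV: "C \<subseteq> carrier_vec n" and z: "0\<^sub>v n \<in> C" and add: "\<And>u v. u \<in> C \<Longrightarrow> v \<in> C \<Longrightarrow> u + v \<in> C"
    and scale: "\<And>a v. v \<in> C \<Longrightarrow> a \<cdot>\<^sub>v v \<in> C" using C unfolding linear_code_of_length_iff by blast+
  have dim: "dim_vec c = n" if "c \<in> C" for c using CV that by auto
  have kn: "ks ! l < n" if "l < length ks" for l using ks nth_mem[OF that] by blast
  show ?thesis unfolding linear_code_of_length_iff coord_minor_def
  proof (intro conjI ballI allI)
    show "?f ` ?S \<subseteq> carrier_vec (length ks)" by auto
    have "0\<^sub>v n \<in> ?S" using z X by auto
    moreover have "?f (0\<^sub>v n) = 0\<^sub>v (length ks)" using kn by auto
    ultimately show "0\<^sub>v (length ks) \<in> ?f ` ?S" by (rule rev_image_eqI[OF _ sym])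
  next
    fix u v assume "u \<in> ?f ` ?S" "v \<in> ?f ` ?S"
    then obtain c d where cd: "c \<in> ?S" "d \<in> ?S" "u = ?f c" "v = ?f d" by blast
    have "u + v = ?f (c + d)" unfolding cd using kn cd(1,2) by (intro eq_vecI) (auto simp: dim)
    moreover have "c + d \<in> ?S" using cd(1,2) X add by (auto simp: dim)
    ultimately show "u + v \<in> ?f ` ?S" by blast
  next
    fix a v assume "v \<in> ?f ` ?S"
    then obtain c where c: "c \<in> ?S" "v = ?f c" by blast
    have "a \<cdot>\<^sub>v v = ?f (a \<cdot>\<^sub>v c)" unfolding c using kn c(1) by (intro eq_vecI) (auto simp: dim)
    moreover have "a \<cdot>\<^sub>v c \<in> ?S" using c(1) X scale by (auto simp: dim)
    ultimately show "a \<cdot>\<^sub>v v \<in> ?f ` ?S" by blast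
  qed
qed

lemma drop_coord_vec:
  "drop_coord (length as) (vec (length (as @ i # bs)) (\<lambda>l. c $ ((as @ i # bs) ! l))) =
     vec (length (as @ bs)) (\<lambda>l. c $ ((as @ bs) ! l))"
  unfolding drop_coord_def by (rule eq_vecI) (auto simp: nth_append Suc_diff_le)

lemma puncture_coord_minor:
  "puncture (length as) (coord_minor C (as @ i # bs) X) = coord_minor C (as @ bs) X"
  unfolding puncture_def coord_minor_def image_image drop_coord_vec ..

lemma shorten_coord_minor:
  "shorten (length as) (coord_minor C (as @ i # bs) X) = coord_minor C (as @ bs) (insert i X)"
proof -
  let ?ks = "as @ i # bs"
  have "{c \<in> coord_minor C ?ks X. c $ length as = 0} =
      (\<lambda>c. vec (length ?ks) (\<lambda>l. c $ (?ks ! l))) ` {c \<in> C. \<forall>x\<in>insert i X. c $ x = 0}"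
    unfolding coord_minor_def by (auto simp: nth_append)
  then show ?thesis unfolding shorten_def by (simp only: image_image drop_coord_vec coord_minor_def)
qed

text \<open>The coordinates in \<open>R\<close> are removed one at a time, those in \<open>X\<close>
  by shortening and the others by puncturing. \<open>proper_code_minor\<close> is a transitive
  closure without reflexivity, so the empty \<open>R\<close> is a case of its own.\<close>

lemma coord_minor_proper:
  assumes C: "linear_code_of_length n C"
  shows "finite R \<Longrightarrow> R \<subseteq> {..<n} \<Longrightarrow> X \<subseteq> R \<Longrightarrow>
    \<exists>ks. distinct ks \<and> set ks = {..<n} - R \<and>
      (if R = {} then coord_minor C ks X = C else proper_code_minor (coord_minor C ks X) C)"
proof (induction R arbitrary: X rule: finite_induct)
  case empty
  have CV: "C \<subseteq> carrier_vec n" using C unfolding linear_code_of_length_iff by blast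
  have "vec n (\<lambda>l. c $ ([0..<n] ! l)) = c" if "c \<in> C" for c
    using CV that by (intro eq_vecI) auto
  then have "coord_minor C [0..<n] {} = C" unfolding coord_minor_def by simp
  then show ?case using empty by (intro exI[of _ "[0..<n]"]) auto
next
  case (insert i R)
  obtain ks where ks: "distinct ks" "set ks = {..<n} - R"
    and D: "if R = {} then coord_minor C ks (X - {i}) = C else proper_code_minor (coord_minor C ks (X - {i})) C"
    using insert.IH[of "X - {i}"] insert.prems by blast
  have "i \<in> set ks" using insert ks by auto
  then obtain as bs where ab: "ks = as @ i # bs" by (meson split_list)
  let ?D = "coord_minor C ks (X - {i})" and ?D' = "coord_minor C (as @ bs) X"
  have "linear_code_of_length (length ks) ?D"
    by (rule coord_minor_linear[OF C]) (use ks insert.prems in auto)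
  moreover have "?D' = puncture (length as) ?D \<or> ?D' = shorten (length as) ?D"
    unfolding ab puncture_coord_minor shorten_coord_minor by (cases "i \<in> X") (auto simp: insert_absorb)
  ultimately have step: "code_minor_step ?D' ?D"
    unfolding code_minor_step_def by (intro exI[of _ "length ks"] exI[of _ "length as"]) (auto simp: ab)
  have "proper_code_minor ?D' C"
  proof (cases "R = {}")
    case True
    then show ?thesis using step D unfolding proper_code_minor_def by auto
  next
    case False
    then show ?thesis using step D unfolding proper_code_minor_def by (auto intro: tranclp_into_tranclp2)
  qed
  moreover have "distinct (as @ bs)" "set (as @ bs) = {..<n} - insert i R"
    using ks unfolding ab by auto
  ultimately show ?case by (intro exI[of _ "as @ bs"]) auto
qed

lemma coord_minor_repr:
  assumes C: "linear_code_of_length n (C :: 'f::{field,finite} vec set)"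
    and ks: "distinct ks" "set ks \<subseteq> {..<n}" and X: "X \<subseteq> {..<n}"
  shows "\<exists>h. repr (code_matroid (coord_minor C ks X)) h (shortened (vec_code n C) X) \<and>
    h ` ground (code_matroid (coord_minor C ks X)) = set ks"
proof -
  let ?D = "coord_minor C ks X" and ?m = "length ks"
  have D: "linear_code_of_length ?m ?D" by (rule coord_minor_linear[OF C ks(2) X])
  have kn: "ks ! l < n" if "l < ?m" for l using ks(2) nth_mem[OF that] by blast
  have m1: "map (\<lambda>i. if i < ?m then vec ?m (\<lambda>l. c $ (ks ! l)) $ i else 0) [0..<?m] =
      map (\<lambda>i. if i < n then c $ i else 0) ks" for c :: "'f vec"
    using kn by (intro nth_equalityI) auto
  have sh: "shortened (vec_code n C) X = (\<lambda>v i. if i < n then v $ i else 0) ` {c \<in> C. \<forall>x\<in>X. c $ x = 0}"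
    unfolding shortened_def vec_code_def using X by (auto simp: subset_iff)
  have "(\<lambda>c. map c [0..<?m]) ` vec_code ?m ?D = (\<lambda>c. map c ks) ` shortened (vec_code n C) X"
    unfolding sh unfolding vec_code_def coord_minor_def image_image m1 ..
  then show ?thesis
    using repr_transfer[OF code_matroid_repr(1)[OF D], of "[0..<?m]" ks] ks(1)
      code_matroid_repr(2)[OF D] by (simp add: atLeast0LessThan)
qed

lemma trellis_width_coord_minor_le_iff:
  assumes C: "linear_code_of_length n (C :: 'f::{field,finite} vec set)"
    and ks: "distinct ks" "set ks \<subseteq> {..<n}" and X: "X \<subseteq> {..<n}"
  shows "trellis_width (coord_minor C ks X) \<le> int w \<longleftrightarrow>
    (\<exists>es. ordering_le (set ks) (shortened (vec_code n C) X) w es)"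
proof -
  obtain h where h: "repr (code_matroid (coord_minor C ks X)) h (shortened (vec_code n C) X)"
    "h ` ground (code_matroid (coord_minor C ks X)) = set ks" using coord_minor_repr[OF assms] by blast
  show ?thesis
    using repr_pathwidth_le_iff[OF h(1) shortened_fcode[OF code_matroid_repr(3)[OF C]], of w] h(2)
    unfolding trellis_width_def by simp
qed

section \<open>Bounding the excluded minors\<close>

lemma ordering_le_empty:
  fixes C :: "('e \<Rightarrow> 'f::{field,finite}) set"
  assumes "fcode C"
  shows "ordering_le {} C w []"
proof -
  have "crank C {} = 0" using crank_le_card[of "{}" C] fcode_zero[OF assms] by auto
  then show ?thesis unfolding ordering_le_def lam_def by simp
qed

lemma increasing_sequence:
  fixes sz :: "'a \<Rightarrow> nat"
  assumes "\<forall>N. \<exists>x\<in>S. N < sz x"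
  shows "\<exists>F :: nat \<Rightarrow> 'a. (\<forall>i. F i \<in> S) \<and> (\<forall>i j. i < j \<longrightarrow> sz (F i) < sz (F j))"
proof -
  obtain f where f: "\<And>N. f N \<in> S" "\<And>N. N < sz (f N)" using assms by metis
  define F where "F = rec_nat (f 0) (\<lambda>_ x. f (sz x))"
  have Suc: "F (Suc i) = f (sz (F i))" for i unfolding F_def by simp
  have "F i \<in> S" for i by (cases i) (auto simp: F_def f)
  moreover have "sz (F i) < sz (F j)" if "i < j" for i j
    using lift_Suc_mono_less[of "\<lambda>i. sz (F i)" i j] that f(2) unfolding Suc by blast
  ultimately show ?thesis by blast
qed

lemma matroid_excluded_minors_bounded:
  fixes w :: nat
  shows "\<exists>N. \<forall>M \<in> matroid_excluded_minors TYPE('f::{field,finite})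
     (pathwidth_class TYPE('f) (int w)) :: 'a matroid set. card (ground M) \<le> N"
proof (rule ccontr)
  let ?P = "pathwidth_class TYPE('f) (int w) :: 'a matroid set"
  let ?S = "matroid_excluded_minors TYPE('f) ?P"
  assume "\<not> (\<exists>N. \<forall>M\<in>?S. card (ground M) \<le> N)"
  then have "\<forall>N. \<exists>M\<in>?S. N < card (ground M)" by (meson not_le)
  then obtain M where S: "\<forall>i::nat. M i \<in> ?S" and lt: "\<forall>i j. i < j \<longrightarrow> card (ground (M i)) < card (ground (M j))"
    using increasing_sequence[of ?S "\<lambda>M. card (ground M)"] by blast
  have ex: "representable TYPE('f) (M i)" "M i \<notin> ?P" "\<And>N. proper_matroid_minor N (M i) \<Longrightarrow> N \<in> ?P" for i
    using S unfolding matroid_excluded_minors_def by blast+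
  have "\<exists>g (C :: (nat \<Rightarrow> 'f) set). repr (M i) g C \<and> fcode C" for i
  proof -
    obtain A :: "'f mat" where m: "is_matroid (M i)" and "matroid_iso (M i) (vector_matroid A)"
      using ex(1) unfolding representable_def by blast
    then obtain f where "bij_betw f (ground (M i)) (ground (vector_matroid A))"
      "indeps (vector_matroid A) = (\<lambda>I. f ` I) ` indeps (M i)" unfolding matroid_iso_def by blast
    moreover have "indeps (M i) \<subseteq> Pow (ground (M i))" using m unfolding is_matroid_def by blast
    ultimately have "repr (M i) (id \<circ> f) (row_code A)" by (intro repr_iso(1)[OF repr_vector_matroid])
    then show ?thesis using row_code_fcode[of A] by blast
  qed
  then obtain g and C :: "nat \<Rightarrow> (nat \<Rightarrow> 'f) set" where r: "\<And>i. repr (M i) (g i) (C i)" and C: "\<And>i. fcode (C i)"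
    by metis
  let ?E = "\<lambda>i. g i ` ground (M i)"
  have fin: "finite (ground (M i))" and inj: "inj_on (g i) (ground (M i))" for i
    using r[of i] unfolding repr_def by auto
  have notle: "\<not> (\<exists>es. ordering_le E D w es)" if "repr (M i) h D" "h ` ground (M i) = E" "fcode D" for i h E and D :: "(nat \<Rightarrow> 'f) set"
    using repr_pathwidth_le_iff[OF that(1,3), of w] that(2) ex(1,2)[of i] unfolding pathwidth_class_def by blast
  have minor: "\<exists>es. ordering_le (g i ` (ground (M i) - X - Y)) (shortened (C i) (g i ` X)) w es"
    if "X \<subseteq> ground (M i)" "Y \<subseteq> ground (M i)" "X \<inter> Y = {}" "X \<union> Y \<noteq> {}" for i X Y
  proof -
    let ?N = "matroid_delete (matroid_contract (M i) X) Y"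
    have "proper_matroid_minor ?N (M i)" unfolding proper_matroid_minor_def using that by blast
    then have "pathwidth ?N \<le> int w" using ex(3) unfolding pathwidth_class_def by blast
    moreover have "repr ?N (g i) (shortened (C i) (g i ` X))"
      by (intro repr_delete repr_contract r C that)
    ultimately show ?thesis using repr_pathwidth_le_iff[OF _ shortened_fcode[OF C]] by fastforce
  qed
  have ord: "\<exists>es. ordering_le (?E i) (C i) (Suc w) es" for i
  proof -
    \<comment> \<open>The empty matroid has pathwidth 0 and is no excluded minor, so there is an
      element to delete.\<close>
    have "ground (M i) \<noteq> {}"
    proof
      assume "ground (M i) = {}"
      then show False using notle[OF r refl C, of i] ordering_le_empty[OF C[of i], of w] by auto
    qed
    then obtain x where x: "x \<in> ground (M i)" by blast
    have "\<exists>es. ordering_le (?E i - {g i x}) (C i) w es"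
      using minor[of "{}" i "{x}"] x inj_on_image_set_diff[OF inj[of i], of "ground (M i)" "{x}"] by simp
    then show ?thesis using ordering_le_insert[OF C, of "?E i" "g i x"] fin[of i] x by blast
  qed
  obtain i j es ks X where ij: "i < j" and es: "distinct es" "set es = ?E i"
    and ks: "distinct ks" "length ks = length es" "set ks \<subseteq> ?E j - X" and X: "X \<subseteq> ?E j"
    and eq: "(\<lambda>c. map c es) ` C i = (\<lambda>c. map c ks) ` shortened (C j) X"
    using code_minor_in_sequence[of C ?E "Suc w", OF C finite_imageI[OF fin] ord]
    by (elim exE conjE) (rule that)
  obtain h where h: "repr (M i) h (shortened (C j) X)" "h ` ground (M i) = set ks"
    using repr_transfer[OF r es ks(1,2) eq] by blast
  \<comment> \<open>Pull the contracted and the deleted coordinates back to elements of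
    \<open>M j\<close>.\<close>
  define X' where "X' = {x \<in> ground (M j). g j x \<in> X}"
  define Y' where "Y' = {x \<in> ground (M j). g j x \<notin> X \<and> g j x \<notin> set ks}"
  have gX: "g j ` X' = X" using X unfolding X'_def by auto
  have gk: "g j ` (ground (M j) - X' - Y') = set ks" using ks(3) unfolding X'_def Y'_def by auto
  have sub: "X' \<subseteq> ground (M j)" "Y' \<subseteq> ground (M j)" "X' \<inter> Y' = {}"
    unfolding X'_def Y'_def by auto
  \<comment> \<open>Strictly growing sizes make the minor proper.\<close>
  have ne: "X' \<union> Y' \<noteq> {}"
  proof
    assume "X' \<union> Y' = {}"
    then have "set ks = ?E j" using gk by auto
    then have "card (set ks) = card (ground (M j))" using card_image[OF inj] by simp
    moreover have "card (set ks) = card (ground (M i))"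
      using ks(1,2) es distinct_card[of ks] distinct_card[of es] card_image[OF inj[of i]] by simp
    ultimately show False using lt ij by fastforce
  qed
  have "\<exists>es. ordering_le (set ks) (shortened (C j) X) w es"
    using minor[OF sub ne] unfolding gX gk .
  then show False using notle[OF h shortened_fcode[OF C]] by blast
qed

section \<open>Isomorphism classes of matroids of bounded size\<close>

lemma matroid_iso_sym:
  assumes "matroid_iso M N" "indeps M \<subseteq> Pow (ground M)"
  shows "matroid_iso N M"
proof -
  obtain f where f: "bij_betw f (ground M) (ground N)" "indeps N = (\<lambda>I. f ` I) ` indeps M"
    using assms(1) unfolding matroid_iso_def by blast
  let ?g = "inv_into (ground M) f"
  have "?g ` f ` I = I" if "I \<in> indeps M" for I
    using f(1) assms(2) that unfolding bij_betw_def by (intro inv_into_image_cancel) auto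
  then have "indeps M = (\<lambda>I. ?g ` I) ` indeps N" unfolding f(2) image_image by simp
  then show ?thesis using bij_betw_inv_into[OF f(1)] unfolding matroid_iso_def by blast
qed

lemma matroid_iso_trans:
  assumes "matroid_iso M N" "matroid_iso N P"
  shows "matroid_iso M P"
proof -
  obtain f where f: "bij_betw f (ground M) (ground N)" "indeps N = (\<lambda>I. f ` I) ` indeps M"
    using assms(1) unfolding matroid_iso_def by blast
  obtain g where g: "bij_betw g (ground N) (ground P)" "indeps P = (\<lambda>I. g ` I) ` indeps N"
    using assms(2) unfolding matroid_iso_def by blast
  show ?thesis unfolding matroid_iso_def
    using bij_betw_trans[OF f(1) g(1)] f(2) g(2)
    by (intro exI[of _ "g \<circ> f"]) (simp add: image_image image_comp)
qed

text \<open>\<open>V\<close> replaces each matroid by an isomorphic one on an initial segment of the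
  naturals with at most \<open>N\<close> elements. There are finitely many of these, and each
  determines its class.\<close>

lemma finite_quotient_if_bounded:
  fixes S :: "'a matroid set"
  assumes rep: "\<And>M. M \<in> S \<Longrightarrow> representable TYPE('f::field) M" and bound: "\<And>M. M \<in> S \<Longrightarrow> card (ground M) \<le> N"
  shows "finite (S // matroid_iso_rel)"
proof -
  have "\<forall>M\<in>S. \<exists>A :: 'f mat. matroid_iso M (vector_matroid A)" using rep unfolding representable_def by blast
  then obtain A :: "'a matroid \<Rightarrow> 'f mat" where A: "\<And>M. M \<in> S \<Longrightarrow> matroid_iso M (vector_matroid (A M))" by metis
  define V where "V M = vector_matroid (A M)" for M
  have sym: "matroid_iso (V M) M" if "M \<in> S" for M
  proof -
    have "indeps M \<subseteq> Pow (ground M)" using rep[OF that] unfolding representable_def is_matroid_def by blast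
    then show ?thesis unfolding V_def by (rule matroid_iso_sym[OF A[OF that]])
  qed
  let ?T = "(\<lambda>(g, I). \<lparr>ground = g, indeps = I\<rparr>) ` (Pow {..<N} \<times> Pow (Pow {..<N}))"
  have "V M \<in> ?T" if M: "M \<in> S" for M
  proof -
    have "card (ground M) = card {..<dim_col (A M)}"
      using A[OF M] bij_betw_same_card unfolding matroid_iso_def vector_matroid_def by fastforce
    then have "dim_col (A M) \<le> N" using bound[OF M] by simp
    then show ?thesis unfolding V_def vector_matroid_def
      by (intro image_eqI[of _ _ "({..<dim_col (A M)}, indeps (vector_matroid (A M)))"])
        (auto simp: vector_matroid_def)
  qed
  then have "V ` S \<subseteq> ?T" by blast
  then have finV: "finite (V ` S)" by (rule finite_subset) auto
  have "matroid_iso_rel `` {M} = {P. matroid_iso (V M) P}" if M: "M \<in> S" for M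
    using matroid_iso_trans[OF sym[OF M]] matroid_iso_trans[OF A[OF M, folded V_def]]
    unfolding matroid_iso_rel_def by blast
  then have "S // matroid_iso_rel = (\<lambda>v. {P. matroid_iso v P}) ` V ` S"
    unfolding quotient_def image_image by auto
  then show ?thesis using finV by simp
qed

text \<open>This runs parallel to the matroid bound instead of being derived from it, since here
  proper minors are those of codes; \<open>coord_minor\<close> takes the place of deletion and
  contraction.\<close>

lemma code_excluded_minors_bounded:
  fixes w :: nat
  shows "\<exists>N. \<forall>n C. (C :: 'f::{field,finite} vec set) \<in> code_excluded_minors (pathwidth_code_family (int w)) \<longrightarrow>
    linear_code_of_length n C \<longrightarrow> n \<le> N"
proof (rule ccontr)
  let ?P = "pathwidth_code_family (int w) :: 'f vec set set"
  let ?S = "{(n, C). C \<in> code_excluded_minors ?P \<and> linear_code_of_length n C}"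
  assume "\<not> (\<exists>N. \<forall>n C. C \<in> code_excluded_minors ?P \<longrightarrow> linear_code_of_length n C \<longrightarrow> n \<le> N)"
  then have "\<forall>N. \<exists>x\<in>?S. N < fst x" by (fastforce simp: not_le)
  then obtain F where F: "\<forall>i::nat. F i \<in> ?S" and lt: "\<forall>i j. i < j \<longrightarrow> fst (F i) < fst (F j)"
    using increasing_sequence[of ?S fst] by blast
  define n where "n i = fst (F i)" for i
  define C where "C i = snd (F i)" for i
  have "F i = (n i, C i)" for i unfolding n_def C_def by simp
  then have ex: "C i \<in> code_excluded_minors ?P" and lin: "linear_code_of_length (n i) (C i)" for i
    using F by (metis (no_types, lifting) case_prod_conv mem_Collect_eq)+
  have nle: "\<not> trellis_width (C i) \<le> int w" for i
    using ex[of i] unfolding code_excluded_minors_def pathwidth_code_family_def by blast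
  have minor: "\<exists>es. ordering_le ({..<n i} - R) (shortened (vec_code (n i) (C i)) X) w es"
    if R: "R \<subseteq> {..<n i}" "R \<noteq> {}" and X: "X \<subseteq> R" for i R X
  proof -
    obtain ks where ks: "distinct ks" "set ks = {..<n i} - R" "proper_code_minor (coord_minor (C i) ks X) (C i)"
      using coord_minor_proper[OF lin finite_subset[OF R(1)] R(1) X] R(2) by auto
    then have "trellis_width (coord_minor (C i) ks X) \<le> int w"
      using ex[of i] unfolding code_excluded_minors_def pathwidth_code_family_def by blast
    then show ?thesis
      using trellis_width_coord_minor_le_iff[OF lin ks(1), of i X w] ks(2) R(1) X by auto
  qed
  have fC: "fcode (vec_code (n i) (C i))" for i using code_matroid_repr(3)[OF lin] .
  have ord: "\<exists>es. ordering_le {..<n i} (vec_code (n i) (C i)) (Suc w) es" for i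
  proof -
    have "n i \<noteq> 0"
    proof
      assume "n i = 0"
      then have "ordering_le {..<n i} (vec_code (n i) (C i)) w []" using ordering_le_empty[OF fC[of i]] by simp
      then show False using nle[of i] trellis_width_le_iff[OF lin[of i]] by blast
    qed
    then have "\<exists>es. ordering_le ({..<n i} - {0}) (vec_code (n i) (C i)) w es"
      using minor[of "{0}" i "{}"] by simp
    then show ?thesis using ordering_le_insert[OF fC, of "{..<n i}" 0] \<open>n i \<noteq> 0\<close> by blast
  qed
  obtain i j es ks X where ij: "i < j" and es: "distinct es" "set es = {..<n i}"
    and ks: "distinct ks" "length ks = length es" "set ks \<subseteq> {..<n j} - X" and X: "X \<subseteq> {..<n j}"
    and eq: "(\<lambda>c. map c es) ` vec_code (n i) (C i) = (\<lambda>c. map c ks) ` shortened (vec_code (n j) (C j)) X"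
    using code_minor_in_sequence[of "\<lambda>i. vec_code (n i) (C i)" "\<lambda>i. {..<n i}" "Suc w",
        OF fC finite_lessThan ord] by (elim exE conjE) (rule that)
  have gr: "set es = id ` ground (code_matroid (C i))"
    unfolding code_matroid_repr(2)[OF lin] es(2) by simp
  obtain h where h: "repr (code_matroid (C i)) h (shortened (vec_code (n j) (C j)) X)"
    "h ` ground (code_matroid (C i)) = set ks"
    using repr_transfer[OF code_matroid_repr(1)[OF lin] es(1) gr ks(1,2) eq] by (elim exE conjE) (rule that)
  have "card (set ks) = n i"
    using distinct_card[OF ks(1)] distinct_card[OF es(1)] unfolding es(2) ks(2) by simp
  moreover have "n i < n j" unfolding n_def by (rule lt[rule_format, OF ij])
  ultimately have ne: "set ks \<noteq> {..<n j}" by (metis card_lessThan less_irrefl)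
  have "\<exists>es. ordering_le ({..<n j} - ({..<n j} - set ks)) (shortened (vec_code (n j) (C j)) X) w es"
  proof (rule minor)
    show "{..<n j} - set ks \<noteq> {}" using ne ks(3) by blast
    show "X \<subseteq> {..<n j} - set ks" using ks(3) X by blast
  qed blast
  moreover have "{..<n j} - ({..<n j} - set ks) = set ks" using ks(3) by auto
  ultimately have "pathwidth (code_matroid (C i)) \<le> int w"
    using repr_pathwidth_le_iff[OF h(1) shortened_fcode[OF fC]] h(2) by simp
  then show False using nle unfolding trellis_width_def by blast
qed

theorem theorem4p1:
  fixes w :: int
  assumes "w > 0"
  shows "finite ((matroid_excluded_minors TYPE('f::{field,finite})
                    (pathwidth_class TYPE('f) w) :: 'a matroid set) // matroid_iso_rel)
       \<and> finite (code_excluded_minors (pathwidth_code_family w :: 'f vec set set))"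
proof
  have w: "int (nat w) = w" using assms by simp
  let ?S = "matroid_excluded_minors TYPE('f) (pathwidth_class TYPE('f) w) :: 'a matroid set"
  obtain N where "\<forall>M\<in>?S. card (ground M) \<le> N"
    using matroid_excluded_minors_bounded[where 'f='f and 'a='a, of "nat w"] unfolding w by blast
  then show "finite (?S // matroid_iso_rel)"
    by (intro finite_quotient_if_bounded[where 'f='f and N=N]) (auto simp: matroid_excluded_minors_def)
  let ?T = "code_excluded_minors (pathwidth_code_family w :: 'f vec set set)"
  obtain N' where N': "\<forall>n C. C \<in> ?T \<longrightarrow> linear_code_of_length n C \<longrightarrow> n \<le> N'"
    using code_excluded_minors_bounded[where 'f='f, of "nat w"] unfolding w by blast
  \<comment> \<open>Over a finite field there are only finitely many codes of bounded length, so
    finiteness holds here without passing to equivalence classes.\<close>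
  have "?T \<subseteq> (\<Union>n\<le>N'. Pow (carrier_vec n))"
  proof
    fix C assume C: "C \<in> ?T"
    then obtain n where n: "linear_code_of_length n C"
      unfolding code_excluded_minors_def linear_code_def by blast
    then have "C \<subseteq> carrier_vec n" unfolding linear_code_of_length_iff by blast
    then show "C \<in> (\<Union>n\<le>N'. Pow (carrier_vec n))" using N' C n by blast
  qed
  then show "finite ?T" by (rule finite_subset) (simp add: finite_carrier_vec)
qed

end
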